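(* Let $n$ be a positive integer and $1\le i,j\le n$. Then $$m_n^{n,n}(i,j)=\frac{1}{n^2}\sum_{d\mid n} d^{n/d}\,(n/d)!\,\phi(d)^2\,\frac{\mu\!\left(\frac{d}{\gcd(i,d)}\right)\mu\!\left(\frac{d}{\gcd(j,d)}\right)}{\phi\!\left(\frac{d}{\gcd(i,d)}\right)\phi\!\left(\frac{d}{\gcd(j,d)}\right)},$$ where $\mu$ is the number-theoretic Möbius function and $\phi$ is Euler's totient function.
   Context: $S_n$ is the symmetric group on $[n]$. For $\pi=a_1\cdots a_n\in S_n$, $\mathrm{maj}\,\pi=\sum_{a_i>a_{i+1}} i$. For positive integers $k,l$ and nonnegative integers $i,j$, $m_n^{k,l}(i,j)=\#\{\pi\in S_n:\ \mathrm{maj}\,\pi\equiv i \pmod k,\ \mathrm{maj}\,\pi^{-1}\equiv j\pmod l\}$. *)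

theory Defs
  imports
    Complex_Main
    "HOL-Combinatorics.Permutations"
    "HOL-Computational_Algebra.Squarefree"
    "HOL-Number_Theory.Cong"
    "HOL-Number_Theory.Totient"
begin

text \<open>A permutation \<open>\<pi> = a\<^sub>1 \<dots> a\<^sub>n\<close> of \<open>{1..n}\<close> is a function with \<open>\<pi> permutes {1..n}\<close>,
  where \<open>a\<^sub>i = \<pi> i\<close>.\<close>

definition maj :: "nat \<Rightarrow> (nat \<Rightarrow> nat) \<Rightarrow> nat" where
  "maj n \<pi> = (\<Sum>i | 1 \<le> i \<and> i < n \<and> \<pi> i > \<pi> (i + 1). i)"

definition maj_count :: "nat \<Rightarrow> nat \<Rightarrow> nat \<Rightarrow> nat \<Rightarrow> nat \<Rightarrow> nat" where
  "maj_count n k l i j =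
     card {\<pi>. \<pi> permutes {1..n} \<and> [maj n \<pi> = i] (mod k) \<and> [maj n (inv \<pi>) = j] (mod l)}"

definition moebius_mu :: "nat \<Rightarrow> int" where
  "moebius_mu n = (if squarefree n then (-1) ^ card (prime_factors n) else 0)"

end

theory Submission
  imports
    Defs
    "HOL-Analysis.Infinite_Sum"
    "HOL-Analysis.Elementary_Metric_Spaces"
    "HOL-Computational_Algebra.Polynomial"
    "HOL-Library.Product_Lexorder"
begin

text \<open>
  Let \<open>M(x, y)\<close> be the sum of \<open>x\<close> to the power \<open>maj \<pi>\<^sup>-\<^sup>1\<close> times \<open>y\<close> to the power \<open>maj \<pi>\<close> over all \<open>\<pi>\<close> in the
  symmetric group. Counting multisets of \<open>n\<close> pairs of natural numbers in two ways, by sorting them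
  and by Burnside's lemma, shows that \<open>n! M(x, y)\<close> is the sum over all permutations \<open>\<sigma>\<close> of
  \<open>q\<^sub>\<sigma>(x) q\<^sub>\<sigma>(y)\<close>, where \<open>q\<^sub>\<sigma>(x)\<close> is the product of all \<open>1 - x\<^sup>k\<close> with \<open>1 \<le> k \<le> n\<close> divided by the product of
  \<open>1 - x\<^sup>l\<close> over the cycle lengths \<open>l\<close> of \<open>\<sigma>\<close>. As \<open>x\<close> tends radially to a root of unity of order
  \<open>d\<close> dividing \<open>n\<close>, \<open>q\<^sub>\<sigma>(x)\<close> tends to \<open>c = d\<^bsup>n/d\<^esup> (n/d)!\<close> if all cycles of \<open>\<sigma>\<close> have length \<open>d\<close>, and to
  \<open>0\<close> otherwise; taking \<open>y = 0\<close> shows that there are \<open>n!/c\<close> such \<open>\<sigma>\<close>. Hence \<open>M\<close> takes the value \<open>c\<close>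
  at two roots of unity of the same order \<open>d\<close> and vanishes if the orders differ. Fourier inversion
  then expresses the counts through Ramanujan sums, which Hoelder's formula evaluates.
\<close>

section \<open>Ramanujan sums\<close>

text \<open>For \<open>d > 0\<close> these are the primitive \<open>d\<close>-th roots of unity.
  Prescribing all exponents at once makes uniqueness of the order and closure under inverses
  immediate. \<open>roots_of_order 0\<close> is infinite, hence the positivity hypotheses further
  on.\<close>

definition roots_of_order :: "nat \<Rightarrow> complex set" where
  "roots_of_order d = {z. \<forall>k. z ^ k = 1 \<longleftrightarrow> d dvd k}"

lemma roots_of_order_power_eq_1_iff: "z \<in> roots_of_order d \<Longrightarrow> z ^ k = 1 \<longleftrightarrow> d dvd k"
  unfolding roots_of_order_def by blast

lemma ex_root_order:
  fixes z :: complex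
  assumes "z ^ n = 1" "n > 0"
  shows "\<exists>d. z \<in> roots_of_order d"
proof -
  define d where "d = (LEAST k. k > 0 \<and> z ^ k = 1)"
  have d: "d > 0" "z ^ d = 1"
    using LeastI[of "\<lambda>k. k > 0 \<and> z ^ k = 1" n] assms by (auto simp: d_def)
  have least: "\<not> (0 < k \<and> z ^ k = 1)" if "k < d" for k
    using not_less_Least[OF that[unfolded d_def]] by simp
  have "z ^ k = 1 \<longleftrightarrow> d dvd k" for k
  proof -
    have "z ^ k = z ^ (d * (k div d) + k mod d)"
      by simp
    also have "\<dots> = z ^ (k mod d)"
      using d by (simp only: power_add power_mult) simp
    finally have "z ^ k = z ^ (k mod d)" .
    moreover have "z ^ (k mod d) = 1 \<longleftrightarrow> k mod d = 0"
      using least[of "k mod d"] d by auto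
    ultimately show ?thesis
      by (simp add: dvd_eq_mod_eq_0)
  qed
  then show ?thesis
    by (auto simp: roots_of_order_def)
qed

lemma finite_roots_of_order:
  assumes "d > 0"
  shows "finite (roots_of_order d)"
proof (rule finite_subset)
  show "roots_of_order d \<subseteq> {z. z ^ d = 1}"
    by (auto simp: roots_of_order_power_eq_1_iff)
  show "finite {z::complex. z ^ d = 1}"
    using assms by (intro finite_roots_unity) simp
qed

lemma roots_unity_eq_UN_order:
  assumes "n > 0"
  shows "{z::complex. z ^ n = 1} = (\<Union>d\<in>{d. d dvd n}. roots_of_order d)"
proof safe
  fix z :: complex assume "z ^ n = 1"
  then show "z \<in> (\<Union>d\<in>{d. d dvd n}. roots_of_order d)"
    using ex_root_order[OF _ assms] roots_of_order_power_eq_1_iff[where k = n] by blast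
next
  fix z d assume "z \<in> roots_of_order d" "d dvd n"
  then show "z ^ n = 1"
    using roots_of_order_power_eq_1_iff by blast
qed

lemma roots_of_order_unique: "z \<in> roots_of_order d \<Longrightarrow> z \<in> roots_of_order e \<Longrightarrow> d = e"
  by (metis dvd_antisym dvd_refl roots_of_order_power_eq_1_iff)

lemma inverse_roots_of_order: "z \<in> roots_of_order d \<Longrightarrow> inverse z \<in> roots_of_order d"
  unfolding roots_of_order_def mem_Collect_eq power_inverse inverse_eq_1_iff .

lemma sum_roots_unity_eq_sum_order:
  fixes F :: "complex \<Rightarrow> complex"
  assumes "n > 0"
  shows "(\<Sum>z | z ^ n = 1. F z) = (\<Sum>d | d dvd n. \<Sum>z\<in>roots_of_order d. F z)"
  unfolding roots_unity_eq_UN_order[OF assms]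
proof (rule sum.UNION_disjoint)
  show "\<forall>d\<in>{d. d dvd n}. finite (roots_of_order d)"
    using assms by (auto intro!: finite_roots_of_order gr0I)
  show "\<forall>d\<in>{d. d dvd n}. \<forall>e\<in>{d. d dvd n}. d \<noteq> e \<longrightarrow> roots_of_order d \<inter> roots_of_order e = {}"
    by (blast dest: roots_of_order_unique)
qed (use assms in simp)

text \<open>Multiplication by the primitive root \<open>w\<close> permutes the \<open>n\<close>-th
  roots of unity and multiplies the sum by \<open>w ^ i\<close>. Unless \<open>n\<close> divides
  \<open>i\<close>, this factor differs from 1, so the sum vanishes.\<close>

lemma sum_roots_unity_power:
  assumes "n > 0"
  shows "(\<Sum>z | z ^ n = 1. z ^ i) = (if n dvd i then of_nat n else (0::complex))"
proof (cases "n dvd i")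
  case True
  then obtain m where m: "i = n * m" ..
  have "(\<Sum>z::complex | z ^ n = 1. z ^ i) = (\<Sum>z::complex | z ^ n = 1. 1)"
    by (intro sum.cong) (auto simp: m power_mult)
  then show ?thesis
    using True card_roots_unity_eq[OF assms] by simp
next
  case False
  define w where "w = cis (2 * pi / n)"
  have wn: "w ^ n = 1"
    using assms by (simp add: w_def DeMoivre)
  have wi: "w ^ i \<noteq> 1"
  proof
    assume "w ^ i = 1"
    then have "cos (2 * pi * i / n) = 1"
      by (simp add: w_def DeMoivre complex_eq_iff mult_ac)
    then obtain m :: int where "2 * pi * i / n = of_int m * (2 * pi)"
      by (auto simp: cos_one_2pi_int)
    then have "real_of_int (int i) = real_of_int (m * int n)"
      using assms by (simp add: field_simps)
    then have "int i = m * int n"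
      by linarith
    then show False
      using False by (metis dvd_triv_right int_dvd_int_iff)
  qed
  have "w \<noteq> 0"
    by (simp add: w_def)
  then have "(\<Sum>z | z ^ n = 1. z ^ i) = (\<Sum>z | z ^ n = 1. (w * z) ^ i)"
    by (intro sum.reindex_bij_witness[where i = "\<lambda>z. w * z" and j = "\<lambda>z. inverse w * z"])
      (simp_all add: power_mult_distrib power_inverse wn)
  also have "\<dots> = w ^ i * (\<Sum>z | z ^ n = 1. z ^ i)"
    by (simp add: power_mult_distrib sum_distrib_left)
  finally show ?thesis
    using wi False by simp
qed

lemma sum_roots_unity_power_inverse:
  assumes "n > 0"
  shows "(\<Sum>z | z ^ n = 1. z ^ i * inverse z ^ k) = (if [k = i] (mod n) then of_nat n else (0::complex))"
proof -
  have "inverse z = z ^ (n - 1)" if "z ^ n = 1" for z :: complex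
    using that assms by (metis One_nat_def inverse_unique power_eq_if not_gr_zero)
  then have "(\<Sum>z::complex | z ^ n = 1. z ^ i * inverse z ^ k) = (\<Sum>z | z ^ n = 1. z ^ (i + (n - 1) * k))"
    by (intro sum.cong) (auto simp: power_add power_mult)
  also have "n dvd i + (n - 1) * k \<longleftrightarrow> [k = i] (mod n)"
  proof -
    \<comment> \<open>Over the integers the exponent is visibly \<open>i - k\<close> modulo
      \<open>n\<close>; on naturals the subtraction would truncate.\<close>
    have "int (i + (n - 1) * k) = int i - int k + int n * int k"
      using assms by (cases n) (simp_all add: algebra_simps)
    then have "n dvd i + (n - 1) * k \<longleftrightarrow> int n dvd int i - int k"
      by (metis dvd_add_left_iff dvd_triv_left int_dvd_int_iff)
    also have "\<dots> \<longleftrightarrow> [int i = int k] (mod int n)"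
      by (simp add: cong_iff_dvd_diff)
    finally show ?thesis
      by (simp add: cong_int_iff cong_sym_eq)
  qed
  then have "(\<Sum>z::complex | z ^ n = 1. z ^ (i + (n - 1) * k)) = (if [k = i] (mod n) then of_nat n else 0)"
    by (simp add: sum_roots_unity_power[OF assms])
  finally show ?thesis .
qed

section \<open>Hoelder's expression: multiplicativity and divisor sums\<close>

lemma gcd_mult_coprime_nat:
  fixes a b i :: nat
  assumes "coprime a b"
  shows "gcd i (a * b) = gcd i a * gcd i b"
proof (rule dvd_antisym)
  show "gcd i (a * b) dvd gcd i a * gcd i b"
  proof -
    obtain d e where de: "gcd i (a * b) = d * e" "d dvd a" "e dvd b"
      using division_decomp[of "gcd i (a * b)" a b] by auto
    then have "d dvd i" "e dvd i"
      by (metis dvd_mult_left dvd_mult_right gcd_dvd1)+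
    with de show ?thesis
      by (simp add: mult_dvd_mono)
  qed
  have "coprime (gcd i a) (gcd i b)"
    using assms by (meson coprime_divisors gcd_dvd2)
  then show "gcd i a * gcd i b dvd gcd i (a * b)"
    by (simp add: divides_mult mult_dvd_mono)
qed

text \<open>A divisor \<open>d\<close> of \<open>a * b\<close> splits uniquely into a divisor of
  \<open>a\<close> and one of \<open>b\<close>, namely \<open>gcd d a\<close> and
  \<open>gcd d b\<close>.\<close>

lemma sum_divisors_coprime:
  fixes f :: "nat \<Rightarrow> real"
  assumes "coprime a b" "a > 0" "b > 0"
    and mult: "\<And>d e. d dvd a \<Longrightarrow> e dvd b \<Longrightarrow> f (d * e) = f d * f e"
  shows "(\<Sum>d | d dvd a * b. f d) = (\<Sum>d | d dvd a. f d) * (\<Sum>d | d dvd b. f d)"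
proof -
  have "(\<Sum>d | d dvd a. f d) * (\<Sum>d | d dvd b. f d) = (\<Sum>(d, e)\<in>{d. d dvd a} \<times> {e. e dvd b}. f (d * e))"
    unfolding sum_product sum.cartesian_product by (intro sum.cong) (auto simp: mult)
  also have "\<dots> = (\<Sum>d | d dvd a * b. f d)"
  proof (rule sum.reindex_bij_witness[where j = "\<lambda>(d, e). d * e" and i = "\<lambda>d. (gcd d a, gcd d b)"])
    fix p assume "p \<in> {d. d dvd a} \<times> {e. e dvd b}"
    then obtain d e where p: "p = (d, e)" "d dvd a" "e dvd b"
      by auto
    have "coprime e a" "coprime d b"
      using p assms by (meson coprime_divisors coprime_commute dvd_refl)+
    then have "gcd (d * e) a = d" "gcd (d * e) b = e"
      using p by (simp_all add: gcd_mult_left_right_cancel gcd_mult_left_left_cancel gcd_proj1_iff coprime_commute)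
    then show "(gcd (case p of (d, e) \<Rightarrow> d * e) a, gcd (case p of (d, e) \<Rightarrow> d * e) b) = p"
      by (simp add: p)
  next
    fix d assume "d \<in> {d. d dvd a * b}"
    then show "(case (gcd d a, gcd d b) of (d, e) \<Rightarrow> d * e) = d"
      using gcd_mult_coprime_nat[OF assms(1), of d] by (simp add: gcd_proj1_iff)
  qed (auto simp: mult_dvd_mono)
  finally show ?thesis ..
qed

lemma moebius_mu_mult:
  assumes "coprime a b" "a > 0" "b > 0"
  shows "moebius_mu (a * b) = moebius_mu a * moebius_mu b"
proof -
  have "prime_factors a \<inter> prime_factors b = {}"
    using assms by (metis coprime_common_divisor disjoint_iff in_prime_factors_iff not_prime_unit)
  then have "card (prime_factors (a * b)) = card (prime_factors a) + card (prime_factors b)"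
    using assms by (simp add: prime_factors_product card_Un_disjoint)
  then show ?thesis
    using assms by (auto simp: moebius_mu_def squarefree_mult_coprime power_add dest: squarefree_multD)
qed

lemma moebius_mu_1 [simp]: "moebius_mu 1 = 1" "moebius_mu (Suc 0) = 1"
  by (simp_all add: moebius_mu_def)

lemma moebius_mu_prime: "prime p \<Longrightarrow> moebius_mu p = -1"
  by (simp add: moebius_mu_def squarefree_prime prime_factorization_prime)

lemma moebius_mu_prime_power: "prime p \<Longrightarrow> k \<ge> 2 \<Longrightarrow> moebius_mu (p ^ k) = 0"
  by (auto simp: moebius_mu_def squarefree_power_iff)

text \<open>Hoelder's closed form of the Ramanujan sum, the sum of the \<open>i\<close>-th powers of
  the primitive \<open>d\<close>-th roots of unity; see
  \<open>sum_roots_of_order_power\<close>.\<close>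

definition hoelder :: "nat \<Rightarrow> nat \<Rightarrow> real" where
  "hoelder i d = real (totient d) * real_of_int (moebius_mu (d div gcd i d)) / real (totient (d div gcd i d))"

lemma hoelder_mult:
  assumes "coprime a b" "a > 0" "b > 0"
  shows "hoelder i (a * b) = hoelder i a * hoelder i b"
proof -
  have eq: "a * b div gcd i (a * b) = (a div gcd i a) * (b div gcd i b)"
    by (simp add: gcd_mult_coprime_nat[OF assms(1)] div_mult_div_if_dvd)
  have "c div gcd i c dvd c" for c
    by (metis dvd_div_mult_self dvd_triv_left gcd_dvd2)
  then have "coprime (a div gcd i a) (b div gcd i b)"
    using assms(1) by (meson coprime_divisors)
  moreover have "a div gcd i a > 0" "b div gcd i b > 0"
    using assms by (auto simp: div_greater_zero_iff dvd_imp_le)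
  ultimately show ?thesis
    using assms by (simp add: hoelder_def eq moebius_mu_mult totient_mult_coprime)
qed

lemma hoelder_1 [simp]: "hoelder i 1 = 1" "hoelder i (Suc 0) = 1"
  by (simp_all add: hoelder_def)

text \<open>If the gcd is \<open>p ^ m\<close>, then \<open>moebius_mu (p ^ (Suc k - m))\<close> is
  1, -1 or 0 according to whether \<open>m\<close> is \<open>Suc k\<close>, \<open>k\<close> or
  smaller. Written as a difference, the values telescope when summed over the divisors of a prime
  power.\<close>

lemma hoelder_prime_power_Suc:
  assumes p: "prime p"
  shows "hoelder i (p ^ Suc k) =
    (if p ^ Suc k dvd i then real (p ^ Suc k) else 0) - (if p ^ k dvd i then real (p ^ k) else 0)"
proof -
  have "p > 1"
    using p by (rule prime_gt_1_nat)
  obtain m where m: "m \<le> Suc k" "gcd i (p ^ Suc k) = p ^ m"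
    using divides_primepow_nat[OF p, of "gcd i (p ^ Suc k)" "Suc k"] by auto
  have dvd: "p ^ l dvd i \<longleftrightarrow> l \<le> m" if "l \<le> Suc k" for l
  proof -
    have "p ^ l dvd i \<longleftrightarrow> p ^ l dvd gcd i (p ^ Suc k)"
      using that le_imp_power_dvd[OF that, of p] by auto
    then show ?thesis
      using \<open>p > 1\<close> unfolding m(2) by (simp add: dvd_power_iff_le)
  qed
  have quot: "p ^ Suc k div gcd i (p ^ Suc k) = p ^ (Suc k - m)"
    using m \<open>p > 1\<close> by (simp only: m(2)) (simp add: power_diff)
  have tot: "real (totient (p ^ Suc k)) = real (p ^ Suc k) - real (p ^ k)"
    using \<open>p > 1\<close> by (simp only: totient_prime_power_Suc[OF p]) (simp add: of_nat_diff algebra_simps)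
  consider "m = Suc k" | "m = k" | "m < k"
    using m(1) by linarith
  then show ?thesis
  proof cases
    case 1
    then show ?thesis
      unfolding hoelder_def quot tot by (simp add: dvd del: power_Suc)
  next
    case 2
    then show ?thesis
      using \<open>p > 1\<close> unfolding hoelder_def quot tot
      by (simp add: dvd totient_prime[OF p] moebius_mu_prime[OF p] of_nat_diff field_simps del: power_Suc)
         (simp add: field_simps)
  next
    case 3
    then have "moebius_mu (p ^ (Suc k - m)) = 0"
      by (intro moebius_mu_prime_power[OF p]) auto
    then show ?thesis
      using 3 unfolding hoelder_def quot by (simp add: dvd del: power_Suc)
  qed
qed

lemma sum_hoelder_prime_power:
  assumes p: "prime p"
  shows "(\<Sum>d | d dvd p ^ K. hoelder i d) = (if p ^ K dvd i then real (p ^ K) else 0)"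
proof (induction K)
  case (Suc K)
  have "p > 1"
    using p by (rule prime_gt_1_nat)
  have "{d. d dvd p ^ Suc K} = insert (p ^ Suc K) {d. d dvd p ^ K}"
    by (auto simp: divides_primepow_nat[OF p] le_Suc_eq simp del: power_Suc)
  moreover have "\<not> p ^ Suc K dvd p ^ K"
    using \<open>p > 1\<close> by (simp add: dvd_power_iff_le del: power_Suc)
  ultimately show ?case
    using Suc \<open>p > 1\<close> by (simp add: hoelder_prime_power_Suc[OF p] del: power_Suc)
qed simp

text \<open>Strong induction splits off the full power of a prime dividing \<open>n\<close>; both
  sides are multiplicative along this coprime factorisation. The right-hand side is also the power
  sum over all \<open>n\<close>-th roots of unity.\<close>

lemma sum_hoelder:
  assumes "n > 0"
  shows "(\<Sum>d | d dvd n. hoelder i d) = (if n dvd i then real n else 0)"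
  using assms
proof (induction n rule: less_induct)
  case (less n)
  show ?case
  proof (cases "n = 1")
    case False
    then obtain p where p: "prime p" "p dvd n"
      using prime_factor_nat by blast
    define K where "K = multiplicity p n"
    obtain m where m: "n = p ^ K * m" "\<not> p dvd m"
      using multiplicity_decompose'[of n p] less.prems p by (metis K_def not_prime_unit less_numeral_extra(3))
    have "p > 1"
      using p prime_gt_1_nat by blast
    have "K > 0"
      using p less.prems by (simp add: K_def prime_multiplicity_gt_zero_iff)
    have cop: "coprime (p ^ K) m"
      using p m by (simp add: prime_imp_coprime)
    have "m > 0"
      using less.prems m by auto
    moreover have "p ^ K > 1"
      using \<open>p > 1\<close> \<open>K > 0\<close> by (rule one_less_power)
    ultimately have "m < n"
      using m by simp
    have "(\<Sum>d | d dvd n. hoelder i d) = (\<Sum>d | d dvd p ^ K. hoelder i d) * (\<Sum>d | d dvd m. hoelder i d)"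
      unfolding m(1)
    proof (rule sum_divisors_coprime[OF cop])
      fix d e assume de: "d dvd p ^ K" "e dvd m"
      show "hoelder i (d * e) = hoelder i d * hoelder i e"
      proof (rule hoelder_mult)
        show "coprime d e"
          using de cop by (rule coprime_divisors)
        show "d > 0" "e > 0"
          using de \<open>m > 0\<close> \<open>p > 1\<close> by (auto intro: gr0I)
      qed
    qed (use \<open>m > 0\<close> \<open>p > 1\<close> in auto)
    moreover have "n dvd i \<longleftrightarrow> p ^ K dvd i \<and> m dvd i"
      using cop unfolding m(1) by (meson divides_mult dvd_mult_left dvd_mult_right)
    ultimately show ?thesis
      using less.IH[OF \<open>m < n\<close> \<open>m > 0\<close>] unfolding sum_hoelder_prime_power[OF p(1)]
      by (simp add: m(1))
  qed simp
qed

text \<open>Summed over all divisors of \<open>n\<close>, both sides give the same value by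
  \<open>sum_roots_unity_power\<close> and \<open>sum_hoelder\<close>. The proper divisors agree by
  induction, so the terms for \<open>n\<close> itself agree; this replaces Moebius
  inversion.\<close>

lemma sum_roots_of_order_power:
  assumes "d > 0"
  shows "(\<Sum>z\<in>roots_of_order d. z ^ i) = of_real (hoelder i d)"
  using assms
proof (induction d rule: less_induct)
  case (less n)
  define D where "D = {d. d dvd n} - {n}"
  have D: "{d. d dvd n} = insert n D" "n \<notin> D" "finite D"
    using less.prems by (auto simp: D_def)
  have "(\<Sum>d | d dvd n. \<Sum>z\<in>roots_of_order d. z ^ i) = of_real (\<Sum>d | d dvd n. hoelder i d)"
    unfolding sum_roots_unity_eq_sum_order[OF less.prems, symmetric] sum_roots_unity_power[OF less.prems]
      sum_hoelder[OF less.prems] by simp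
  moreover have "(\<Sum>d\<in>D. \<Sum>z\<in>roots_of_order d. z ^ i) = of_real (\<Sum>d\<in>D. hoelder i d)"
    unfolding of_real_sum
  proof (rule sum.cong)
    fix d assume "d \<in> D"
    then have "d dvd n" "d \<noteq> n"
      by (auto simp: D_def)
    then have "d < n" "d > 0"
      using less.prems dvd_imp_le[of d n] by (auto intro: gr0I)
    then show "(\<Sum>z\<in>roots_of_order d. z ^ i) = of_real (hoelder i d)"
      by (rule less.IH)
  qed auto
  ultimately show ?case
    using D(2,3) unfolding D(1) by simp
qed

section \<open>Infinite sums over exponent vectors\<close>

text \<open>The iterated sum gives the value. Joint summability has to be shown separately and
  follows from absolute summability, which for complex summands is the same as summability.\<close>

lemma has_sum_times:
  fixes f :: "'a \<Rightarrow> complex" and g :: "'b \<Rightarrow> complex"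
  assumes f: "(f has_sum a) A" and g: "(g has_sum b) B"
  shows "((\<lambda>(u, v). f u * g v) has_sum a * b) (A \<times> B)"
proof (rule has_sum_SigmaI[where g = "\<lambda>u. f u * b"])
  show "((\<lambda>v. case (u, v) of (u, v) \<Rightarrow> f u * g v) has_sum f u * b) B" for u
    using has_sum_cmult_right[OF g] by simp
  show "((\<lambda>u. f u * b) has_sum a * b) A"
    by (rule has_sum_cmult_left[OF f])
  have "f abs_summable_on A" "g abs_summable_on B"
    using f g by (auto simp flip: summable_on_iff_abs_summable_on_complex dest: has_sum_imp_summable)
  then have "(\<lambda>(u, v). f u * g v) abs_summable_on A \<times> B"
    unfolding abs_summable_on_Sigma_iff
    by (auto simp: norm_mult infsum_cmult_right' abs_mult infsum_nonneg intro: summable_on_cmult_right summable_on_cmult_left)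
  then show "(\<lambda>(u, v). f u * g v) summable_on A \<times> B"
    by (rule abs_summable_summable)
qed

lemma has_sum_Sigma_finite:
  fixes f :: "'a \<times> 'b \<Rightarrow> complex"
  assumes "finite A" and "\<And>a. a \<in> A \<Longrightarrow> ((\<lambda>b. f (a, b)) has_sum s a) (B a)"
  shows "(f has_sum (\<Sum>a\<in>A. s a)) (Sigma A B)"
proof -
  have "(f has_sum s a) ({a} \<times> B a)" if "a \<in> A" for a
  proof -
    have "{a} \<times> B a = Pair a ` B a"
      by auto
    then show ?thesis
      using assms(2)[OF that] has_sum_reindex[of "Pair a" "B a" f "s a"]
      by (simp add: o_def inj_on_def)
  qed
  moreover have "Sigma A B = (\<Union>a\<in>A. {a} \<times> B a)"
    by auto
  ultimately show ?thesis
    using sum_has_sum[OF assms(1), of f "\<lambda>a. {a} \<times> B a" s] by auto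
qed

text \<open>Fixing the value 0 outside \<open>I\<close> gives every exponent vector exactly one
  representative, so reindexing by these sets can be bijective.\<close>

definition funs_on :: "'a set \<Rightarrow> ('a \<Rightarrow> nat) set" where
  "funs_on I = {c. \<forall>i. i \<notin> I \<longrightarrow> c i = 0}"

text \<open>A product of geometric series, one per index; the induction splits off the exponent of
  the new index.\<close>

lemma has_sum_prod_geometric:
  fixes w :: "'a \<Rightarrow> complex"
  assumes "finite I" and "\<And>i. i \<in> I \<Longrightarrow> norm (w i) < 1"
  shows "((\<lambda>c. \<Prod>i\<in>I. w i ^ c i) has_sum (\<Prod>i\<in>I. 1 / (1 - w i))) (funs_on I)"
  using assms
proof (induction I rule: finite_induct)
  case empty
  have "funs_on {} = {\<lambda>_::'a. 0}"
    by (auto simp: funs_on_def)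
  then show ?case
    by (simp add: has_sum_finiteI)
next
  case (insert i I)
  have "((\<lambda>m. w i ^ m) has_sum 1 / (1 - w i)) UNIV"
    using insert.prems[of i] by (intro norm_summable_imp_has_sum geometric_sums) (auto simp: norm_power summable_geometric)
  then have "((\<lambda>(m, c). w i ^ m * (\<Prod>i\<in>I. w i ^ c i)) has_sum
      1 / (1 - w i) * (\<Prod>i\<in>I. 1 / (1 - w i))) (UNIV \<times> funs_on I)"
    using insert by (intro has_sum_times) auto
  also have "?this \<longleftrightarrow> ((\<lambda>c. \<Prod>i\<in>insert i I. w i ^ c i) has_sum
      1 / (1 - w i) * (\<Prod>i\<in>I. 1 / (1 - w i))) (funs_on (insert i I))"
  proof (rule has_sum_reindex_bij_witness[where i = "\<lambda>c. (c i, c(i := 0))" and j = "\<lambda>(m, c). c(i := m)"])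
    show "(\<Prod>j\<in>insert i I. w j ^ (case p of (m, c) \<Rightarrow> c(i := m)) j) = (case p of (m, c) \<Rightarrow> w i ^ m * (\<Prod>i\<in>I. w i ^ c i))"
      if "p \<in> UNIV \<times> funs_on I" for p
    proof -
      obtain m c where p: "p = (m, c)"
        by (cases p)
      have "(\<Prod>j\<in>I. w j ^ (c(i := m)) j) = (\<Prod>j\<in>I. w j ^ c j)"
        using insert(2) by (intro prod.cong) auto
      then show ?thesis
        using insert(1,2) by (simp add: p)
    qed
  qed (use insert(2) in \<open>auto simp: funs_on_def fun_eq_iff\<close>)
  finally show ?case
    using insert(1,2) by simp
qed

section \<open>Generating functions of descent-compatible sequences and of invariant sequences\<close>

text \<open>Stanley's \<open>\<pi>\<close>-partitions, in weakly decreasing form. A strict drop is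
  forced exactly at the positions that \<open>maj\<close> adds up.\<close>

definition descent_partitions :: "nat \<Rightarrow> (nat \<Rightarrow> nat) \<Rightarrow> (nat \<Rightarrow> nat) set" where
  "descent_partitions n \<pi> = {F \<in> funs_on {1..n}. \<forall>k\<in>{1..<n}.
     F (k + 1) \<le> F k \<and> (\<pi> k > \<pi> (k + 1) \<longrightarrow> F (k + 1) < F k)}"

lemma sum_tail_sums:
  fixes a :: "nat \<Rightarrow> nat"
  shows "(\<Sum>k=1..n. \<Sum>i=k..n. a i) = (\<Sum>i=1..n. i * a i)"
proof (induction n)
  case (Suc n)
  have "(\<Sum>k=1..Suc n. \<Sum>i=k..Suc n. a i) = (\<Sum>k=1..n. \<Sum>i=k..Suc n. a i) + a (Suc n)"
    by simp
  also have "(\<Sum>k=1..n. \<Sum>i=k..Suc n. a i) = (\<Sum>k=1..n. (\<Sum>i=k..n. a i) + a (Suc n))"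
    by (intro sum.cong) auto
  finally show ?case
    using Suc by (simp add: sum.distrib)
qed simp

text \<open>After removal of the forced unit \<open>e k\<close>, the drop from \<open>F k\<close> to
  \<open>F (k + 1)\<close> is an arbitrary natural number. A unit of drop at \<open>k\<close> raises
  the first \<open>k\<close> entries and so adds \<open>k\<close> to the total: the forced units
  yield \<open>maj n \<pi>\<close>, the free ones a geometric series in
  \<open>x ^ k\<close>.\<close>

lemma has_sum_descent_partitions:
  fixes x :: complex
  assumes x: "norm x < 1"
  shows "((\<lambda>F. x ^ (\<Sum>k=1..n. F k)) has_sum x ^ maj n \<pi> * (\<Prod>k=1..n. 1 / (1 - x ^ k)))
           (descent_partitions n \<pi>)"
proof -
  define e :: "nat \<Rightarrow> nat" where "e i = (if 1 \<le> i \<and> i < n \<and> \<pi> i > \<pi> (i + 1) then 1 else 0)" for i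
  \<comment> \<open>Tail sums rebuild a sequence from its drops. The value at 0 is reset because the
    sequence must vanish outside \<open>{1..n}\<close>.\<close>
  define J :: "(nat \<Rightarrow> nat) \<Rightarrow> nat \<Rightarrow> nat"
    where "J c k = (if k = 0 then 0 else \<Sum>i=k..n. c i + e i)" for c k
  \<comment> \<open>The last drop, at \<open>k = n\<close>, is measured against
    \<open>F (n + 1) = 0\<close>.\<close>
  define I :: "(nat \<Rightarrow> nat) \<Rightarrow> nat \<Rightarrow> nat"
    where "I F k = (if k \<in> {1..n} then F k - F (k + 1) - e k else 0)" for F k
  have maj: "(\<Sum>i=1..n. i * e i) = maj n \<pi>"
  proof -
    have "(\<Sum>i=1..n. i * e i) = (\<Sum>i\<in>{1..n}. if i < n \<and> \<pi> i > \<pi> (i + 1) then i else 0)"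
      by (intro sum.cong) (auto simp: e_def)
    also have "\<dots> = (\<Sum>i\<in>{i\<in>{1..n}. i < n \<and> \<pi> i > \<pi> (i + 1)}. i)"
      by (rule sum.inter_filter[symmetric]) simp
    also have "\<dots> = maj n \<pi>"
      unfolding maj_def by (intro sum.cong) auto
    finally show ?thesis .
  qed
  have J_step: "J c k = c k + e k + J c (k + 1)" if "k \<in> {1..n}" for c k
    using that by (simp add: J_def sum.atLeast_Suc_atMost)
  have e_n: "e k = 0" if "k \<ge> n" for k
    using that by (simp add: e_def)
  have "((\<lambda>c. \<Prod>i\<in>{1..n}. (x ^ i) ^ c i) has_sum (\<Prod>i\<in>{1..n}. 1 / (1 - x ^ i))) (funs_on {1..n})"
    using x by (intro has_sum_prod_geometric) (auto simp: norm_power power_Suc_less_one power_less_one_iff)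
  then have "((\<lambda>c. x ^ maj n \<pi> * (\<Prod>i\<in>{1..n}. (x ^ i) ^ c i)) has_sum
      x ^ maj n \<pi> * (\<Prod>i\<in>{1..n}. 1 / (1 - x ^ i))) (funs_on {1..n})"
    by (rule has_sum_cmult_right)
  also have "?this \<longleftrightarrow> ?thesis"
  proof (rule has_sum_reindex_bij_witness[where i = I and j = J])
    fix c assume c: "c \<in> funs_on {1..n}"
    show "I (J c) = c"
    proof
      fix k show "I (J c) k = c k"
        using c J_step[of k c] by (auto simp: I_def funs_on_def)
    qed
    show "J c \<in> descent_partitions n \<pi>"
      unfolding descent_partitions_def
    proof (intro CollectI conjI ballI)
      show "J c \<in> funs_on {1..n}"
        by (auto simp: funs_on_def J_def)
      fix k assume "k \<in> {1..<n}"
      then show "J c (k + 1) \<le> J c k" "\<pi> k > \<pi> (k + 1) \<longrightarrow> J c (k + 1) < J c k"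
        using J_step[of k c] by (auto simp: e_def)
    qed
    have "(\<Sum>k=1..n. J c k) = (\<Sum>k=1..n. \<Sum>i=k..n. c i + e i)"
      by (intro sum.cong) (auto simp: J_def)
    also have "\<dots> = (\<Sum>i=1..n. i * c i) + maj n \<pi>"
      unfolding sum_tail_sums by (simp add: distrib_left sum.distrib flip: maj)
    finally show "x ^ (\<Sum>k=1..n. J c k) = x ^ maj n \<pi> * (\<Prod>i\<in>{1..n}. (x ^ i) ^ c i)"
      by (simp add: power_add power_sum power_mult)
  next
    fix F assume F: "F \<in> descent_partitions n \<pi>"
    then have supp: "F k = 0" if "k = 0 \<or> k > n" for k
      using that by (auto simp: descent_partitions_def funs_on_def)
    have drop: "F (k + 1) + e k \<le> F k" if "k \<in> {1..n}" for k
    proof (cases "k = n")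
      case True
      then show ?thesis
        using supp[of "n + 1"] by (simp add: e_n)
    next
      case False
      then show ?thesis
        using F that by (auto simp: descent_partitions_def e_def)
    qed
    show "I F \<in> funs_on {1..n}"
      by (auto simp: I_def funs_on_def)
    have tail: "(\<Sum>i=k..n. I F i + e i) = F k" if "k \<le> Suc n" "k \<ge> 1" for k
      using that
    proof (induction k rule: inc_induct)
      case base
      then show ?case
        using supp[of "Suc n"] by simp
    next
      case (step k)
      then show ?case
        using drop[of k] by (simp add: sum.atLeast_Suc_atMost I_def)
    qed
    show "J (I F) = F"
    proof
      fix k show "J (I F) k = F k"
        using tail[of k] supp[of k] by (cases "k \<le> n") (auto simp: J_def)
    qed
  qed (rule refl)
  finally show ?thesis .
qed

section \<open>Sequences constant on the cycles of a permutation\<close>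

definition invariants :: "nat \<Rightarrow> (nat \<Rightarrow> nat) \<Rightarrow> (nat \<Rightarrow> nat) set" where
  "invariants n \<sigma> = {f \<in> funs_on {1..n}. f \<circ> \<sigma> = f}"

text \<open>Two points lie in the same cycle of \<open>\<sigma>\<close> iff no \<open>\<sigma>\<close>-invariant function separates them.\<close>

definition cycle_rel :: "nat \<Rightarrow> (nat \<Rightarrow> nat) \<Rightarrow> (nat \<times> nat) set" where
  "cycle_rel n \<sigma> = {(u, v). u \<in> {1..n} \<and> v \<in> {1..n} \<and> (\<forall>f\<in>invariants n \<sigma>. f u = f v)}"

definition cycles :: "nat \<Rightarrow> (nat \<Rightarrow> nat) \<Rightarrow> nat set set" where
  "cycles n \<sigma> = {1..n} // cycle_rel n \<sigma>"

lemma equiv_cycle_rel: "equiv {1..n} (cycle_rel n \<sigma>)"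
  by (rule equivI) (auto simp: cycle_rel_def refl_on_def sym_def trans_def)

lemma cycles_partition:
  shows "\<Union> (cycles n \<sigma>) = {1..n}"
    and "finite (cycles n \<sigma>)"
    and "B \<in> cycles n \<sigma> \<Longrightarrow> finite B"
    and "B \<in> cycles n \<sigma> \<Longrightarrow> B \<noteq> {}"
    and "B \<in> cycles n \<sigma> \<Longrightarrow> C \<in> cycles n \<sigma> \<Longrightarrow> B \<noteq> C \<Longrightarrow> B \<inter> C = {}"
proof -
  show U: "\<Union> (cycles n \<sigma>) = {1..n}"
    unfolding cycles_def by (rule Union_quotient[OF equiv_cycle_rel])
  show "finite (cycles n \<sigma>)"
    by (rule finite_UnionD) (simp add: U)
  show "B \<in> cycles n \<sigma> \<Longrightarrow> finite B"
    using U by (metis Union_upper finite_atLeastAtMost finite_subset)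
  show "B \<in> cycles n \<sigma> \<Longrightarrow> B \<noteq> {}"
    unfolding cycles_def by (rule in_quotient_imp_non_empty[OF equiv_cycle_rel])
  show "B \<in> cycles n \<sigma> \<Longrightarrow> C \<in> cycles n \<sigma> \<Longrightarrow> B \<noteq> C \<Longrightarrow> B \<inter> C = {}"
    unfolding cycles_def using quotient_disj[OF equiv_cycle_rel] by blast
qed

lemma sum_card_cycles: "(\<Sum>B\<in>cycles n \<sigma>. card B) = n"
  using card_Union_disjoint[of "cycles n \<sigma>"] cycles_partition[where n = n and \<sigma> = \<sigma>]
  by (simp add: pairwise_def disjnt_def)

text \<open>An invariant sequence amounts to one free value for each cycle, and the value on a cycle
  \<open>B\<close> enters the total \<open>card B\<close> times.\<close>

lemma has_sum_invariants:
  fixes x :: complex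
  assumes x: "norm x < 1" and \<sigma>: "\<sigma> permutes {1..n}"
  shows "((\<lambda>f. x ^ (\<Sum>k=1..n. f k)) has_sum (\<Prod>B\<in>cycles n \<sigma>. 1 / (1 - x ^ card B))) (invariants n \<sigma>)"
proof -
  define cl where "cl u = cycle_rel n \<sigma> `` {u}" for u
  define J :: "(nat set \<Rightarrow> nat) \<Rightarrow> nat \<Rightarrow> nat"
    where "J c u = (if u \<in> {1..n} then c (cl u) else 0)" for c u
  define I :: "(nat \<Rightarrow> nat) \<Rightarrow> nat set \<Rightarrow> nat"
    where "I f B = (if B \<in> cycles n \<sigma> then f (SOME u. u \<in> B) else 0)" for f B
  have cl_cycle: "cl u \<in> cycles n \<sigma>" if "u \<in> {1..n}" for u
    using that by (auto simp: cycles_def cl_def quotientI)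
  have cl_eq: "cl u = B" if "B \<in> cycles n \<sigma>" "u \<in> B" for u B
    using that unfolding cycles_def cl_def
    by (metis Image_singleton_iff equiv_class_eq_iff equiv_cycle_rel quotientE)
  have some_mem: "(SOME u. u \<in> B) \<in> B" if "B \<in> cycles n \<sigma>" for B
    using cycles_partition(4)[OF that] by (simp add: some_in_eq)
  have mem: "u \<in> {1..n}" if "B \<in> cycles n \<sigma>" "u \<in> B" for u B
    using that cycles_partition(1)[of n \<sigma>] by blast
  have "((\<lambda>c. \<Prod>B\<in>cycles n \<sigma>. (x ^ card B) ^ c B) has_sum (\<Prod>B\<in>cycles n \<sigma>. 1 / (1 - x ^ card B)))
      (funs_on (cycles n \<sigma>))"
    using x cycles_partition[where n = n and \<sigma> = \<sigma>]
    by (intro has_sum_prod_geometric) (auto simp: norm_power power_less_one_iff card_gt_0_iff)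
  also have "?this \<longleftrightarrow> ?thesis"
  proof (rule has_sum_reindex_bij_witness[where i = I and j = J])
    fix c assume c: "c \<in> funs_on (cycles n \<sigma>)"
    show "I (J c) = c"
    proof
      fix B show "I (J c) B = c B"
        using c some_mem[of B] mem[of B] cl_eq[of B] by (auto simp: I_def J_def funs_on_def)
    qed
    \<comment> \<open>Every invariant function agrees at \<open>u\<close> and
      \<open>\<sigma> u\<close>, so \<open>cycle_rel\<close> puts the two points in one class, where
      \<open>J c\<close> is constant.\<close>
    have "J c (\<sigma> u) = J c u" for u
    proof (cases "u \<in> {1..n}")
      case True
      moreover have "\<sigma> u \<in> {1..n}"
        using True permutes_in_image[OF \<sigma>, of u] by blast
      moreover have "f u = f (\<sigma> u)" if "f \<in> invariants n \<sigma>" for f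
        using that by (auto simp: invariants_def fun_eq_iff)
      ultimately have "(u, \<sigma> u) \<in> cycle_rel n \<sigma>"
        by (simp add: cycle_rel_def)
      then have "cl (\<sigma> u) = cl u"
        unfolding cl_def by (metis equiv_class_eq equiv_cycle_rel)
      then show ?thesis
        using True \<open>\<sigma> u \<in> {1..n}\<close> by (simp add: J_def)
    qed (use \<sigma> in \<open>simp add: permutes_not_in\<close>)
    then show "J c \<in> invariants n \<sigma>"
      by (auto simp: invariants_def funs_on_def J_def fun_eq_iff)
    have "(\<Sum>u=1..n. J c u) = (\<Sum>u\<in>\<Union>(cycles n \<sigma>). J c u)"
      by (simp only: cycles_partition)
    also have "\<dots> = (\<Sum>B\<in>cycles n \<sigma>. \<Sum>u\<in>B. J c u)"
      using cycles_partition[where n = n and \<sigma> = \<sigma>]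
      by (subst sum.Union_disjoint) (auto simp: disjoint_iff)
    also have "\<dots> = (\<Sum>B\<in>cycles n \<sigma>. \<Sum>u\<in>B. c B)"
      by (intro sum.cong refl) (metis J_def mem cl_eq)
    also have "\<dots> = (\<Sum>B\<in>cycles n \<sigma>. card B * c B)"
      by simp
    finally show "x ^ (\<Sum>k=1..n. J c k) = (\<Prod>B\<in>cycles n \<sigma>. (x ^ card B) ^ c B)"
      by (simp add: power_sum power_mult)
  next
    fix f assume f: "f \<in> invariants n \<sigma>"
    show "I f \<in> funs_on (cycles n \<sigma>)"
      by (auto simp: I_def funs_on_def)
    show "J (I f) = f"
    proof
      fix u show "J (I f) u = f u"
      proof (cases "u \<in> {1..n}")
        case True
        define v where "v = (SOME v. v \<in> cl u)"
        have "v \<in> cl u"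
          unfolding v_def using some_mem[OF cl_cycle[OF True]] .
        then have "(u, v) \<in> cycle_rel n \<sigma>"
          by (simp add: cl_def)
        then have "f u = f v"
          using f by (auto simp: cycle_rel_def)
        then show ?thesis
          using True cl_cycle[OF True] by (simp add: J_def I_def v_def)
      next
        case False
        then show ?thesis
          using f by (auto simp: J_def invariants_def funs_on_def)
      qed
    qed
  qed (rule refl)
  finally show ?thesis .
qed

section \<open>Sorting pairs\<close>

text \<open>The values not exceeding \<open>\<beta> u\<close> are exactly
  \<open>1..\<beta> u\<close>. Hence a permutation can be recovered from the order it induces on the
  points.\<close>

lemma permutation_rank:
  assumes "\<beta> permutes {1..n}" "u \<in> {1..n}"
  shows "card {v \<in> {1..n}. \<beta> v \<le> \<beta> u} = \<beta> u"
proof -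
  have "\<beta> u \<in> {1..n}"
    using assms(2) unfolding permutes_in_image[OF assms(1)] .
  have "\<beta> ` {v \<in> {1..n}. \<beta> v \<le> \<beta> u} = {1..\<beta> u}"
  proof safe
    fix v assume "v \<in> {1..n}"
    then show "\<beta> v \<in> {1..\<beta> u}" if "\<beta> v \<le> \<beta> u"
      using that permutes_in_image[OF assms(1), of v] by simp
  next
    fix k assume k: "k \<in> {1..\<beta> u}"
    then have "k \<in> {1..n}"
      using \<open>\<beta> u \<in> {1..n}\<close> by simp
    then obtain v where "v \<in> {1..n}" "k = \<beta> v"
      using permutes_image[OF assms(1)] by blast
    then show "k \<in> \<beta> ` {v \<in> {1..n}. \<beta> v \<le> \<beta> u}"
      using k by auto
  qed
  moreover have "inj_on \<beta> {v \<in> {1..n}. \<beta> v \<le> \<beta> u}"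
    using permutes_inj[OF assms(1)] by (auto simp: inj_on_def)
  ultimately show ?thesis
    by (metis card_atLeastAtMost card_image diff_Suc_1)
qed

lemma sorting_permutation_unique:
  fixes \<beta> \<gamma> :: "nat \<Rightarrow> nat"
  assumes \<beta>: "\<beta> permutes {1..n}" and \<gamma>: "\<gamma> permutes {1..n}"
    and "\<And>u v. u \<in> {1..n} \<Longrightarrow> v \<in> {1..n} \<Longrightarrow> \<beta> u < \<beta> v \<longleftrightarrow> \<gamma> u < \<gamma> v"
  shows "\<beta> = \<gamma>"
proof
  fix u
  show "\<beta> u = \<gamma> u"
  proof (cases "u \<in> {1..n}")
    case True
    have "{v \<in> {1..n}. \<not> \<beta> u < \<beta> v} = {v \<in> {1..n}. \<not> \<gamma> u < \<gamma> v}"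
      using assms(3)[OF True] by blast
    then show ?thesis
      using permutation_rank[OF \<beta> True] permutation_rank[OF \<gamma> True] by (simp add: not_less)
  next
    case False
    then show ?thesis
      using \<beta> \<gamma> by (simp add: permutes_not_in)
  qed
qed

text \<open>Each point is sent to one more than the number of its \<open>R\<close>-predecessors.
  Totality makes this injective, hence a permutation of the finite set.\<close>

lemma ex_sorting_permutation:
  fixes R :: "nat \<Rightarrow> nat \<Rightarrow> bool"
  assumes trans: "\<And>u v w. R u v \<Longrightarrow> R v w \<Longrightarrow> R u w"
    and irrefl: "\<And>u. \<not> R u u"
    and total: "\<And>u v. u \<in> {1..n} \<Longrightarrow> v \<in> {1..n} \<Longrightarrow> u \<noteq> v \<Longrightarrow> R u v \<or> R v u"
  shows "\<exists>\<beta>. \<beta> permutes {1..n} \<and> (\<forall>u\<in>{1..n}. \<forall>v\<in>{1..n}. \<beta> u < \<beta> v \<longleftrightarrow> R u v)"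
proof -
  define b where "b u = card {v \<in> {1..n}. R v u} + 1" for u
  define \<beta> where "\<beta> u = (if u \<in> {1..n} then b u else u)" for u
  have less: "b u < b v" if "u \<in> {1..n}" "R u v" for u v
  proof -
    have "{w \<in> {1..n}. R w u} \<subset> {w \<in> {1..n}. R w v}"
      using that trans irrefl by blast
    then show ?thesis
      by (simp add: b_def psubset_card_mono)
  qed
  have iff: "b u < b v \<longleftrightarrow> R u v" if "u \<in> {1..n}" "v \<in> {1..n}" for u v
    using less total that by (metis less_asym less_irrefl)
  have range: "b u \<in> {1..n}" if "u \<in> {1..n}" for u
  proof -
    have "card {v \<in> {1..n}. R v u} < card {1..n}"
      using that irrefl by (intro psubset_card_mono) blast+
    then show ?thesis
      by (simp add: b_def)
  qed
  have "inj_on b {1..n}"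
    using iff total by (metis inj_onI less_irrefl)
  then have "bij_betw b {1..n} {1..n}"
    using range unfolding bij_betw_def by (metis endo_inj_surj finite_atLeastAtMost image_subsetI)
  then have "bij_betw \<beta> {1..n} {1..n}"
    by (rule bij_betw_cong[THEN iffD1, rotated]) (simp add: \<beta>_def)
  then have "\<beta> permutes {1..n}"
    by (rule bij_imp_permutes) (auto simp: \<beta>_def)
  then show ?thesis
    using iff by (auto simp: \<beta>_def)
qed

text \<open>\<open>\<alpha> u\<close> is the position of \<open>u\<close> when the keys are listed
  in weakly decreasing order. Ties are left open, so there are as many sortings as permutations
  preserving the key.\<close>

definition sortings :: "nat \<Rightarrow> (nat \<Rightarrow> 'b::linorder) \<Rightarrow> (nat \<Rightarrow> nat) set" where
  "sortings n K = {\<alpha>. \<alpha> permutes {1..n} \<and> (\<forall>u\<in>{1..n}. \<forall>v\<in>{1..n}. K u > K v \<longrightarrow> \<alpha> u < \<alpha> v)}"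

lemma sortings_nonempty: "sortings n K \<noteq> {}"
proof -
  have "\<exists>\<alpha>. \<alpha> permutes {1..n} \<and>
      (\<forall>u\<in>{1..n}. \<forall>v\<in>{1..n}. \<alpha> u < \<alpha> v \<longleftrightarrow> K u > K v \<or> K u = K v \<and> u < v)"
    by (rule ex_sorting_permutation) auto
  then obtain \<alpha> where "\<alpha> permutes {1..n}"
    "\<forall>u\<in>{1..n}. \<forall>v\<in>{1..n}. \<alpha> u < \<alpha> v \<longleftrightarrow> K u > K v \<or> K u = K v \<and> u < v"
    by blast
  then have "\<alpha> \<in> sortings n K"
    by (auto simp: sortings_def)
  then show ?thesis
    by blast
qed

text \<open>If \<open>K u > K v\<close>, every point that \<open>\<alpha>\<close> places up to
  \<open>u\<close> has key at least \<open>K u\<close>, so \<open>\<beta>\<close> places it strictly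
  before \<open>v\<close>. Counting these points gives \<open>\<alpha> u < \<beta> v\<close>, a
  contradiction.\<close>

lemma sortings_key_le:
  assumes \<alpha>: "\<alpha> \<in> sortings n K" and \<beta>: "\<beta> \<in> sortings n K"
    and uv: "u \<in> {1..n}" "v \<in> {1..n}" and eq: "\<alpha> u = \<beta> v"
  shows "K u \<le> K v"
proof (rule ccontr)
  assume less: "\<not> K u \<le> K v"
  have "\<alpha> u = card {w \<in> {1..n}. \<alpha> w \<le> \<alpha> u}"
    using \<alpha> uv permutation_rank[of \<alpha> n u] by (simp add: sortings_def)
  also have "\<dots> \<le> card {w \<in> {1..n}. \<beta> w < \<beta> v}"
  proof (rule card_mono)
    show "{w \<in> {1..n}. \<alpha> w \<le> \<alpha> u} \<subseteq> {w \<in> {1..n}. \<beta> w < \<beta> v}"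
    proof safe
      fix w assume w: "w \<in> {1..n}" "\<alpha> w \<le> \<alpha> u"
      then have "\<not> K w < K u"
        using \<alpha> uv unfolding sortings_def by (metis (mono_tags, lifting) leD mem_Collect_eq)
      then have "K w > K v"
        using less by auto
      then show "\<beta> w < \<beta> v"
        using \<beta> uv w unfolding sortings_def by blast
    qed
  qed simp
  also have "\<dots> < card {w \<in> {1..n}. \<beta> w \<le> \<beta> v}"
    using uv by (intro psubset_card_mono) auto
  also have "\<dots> = \<beta> v"
    using \<beta> uv permutation_rank[of \<beta> n v] by (simp add: sortings_def)
  finally show False
    using eq by simp
qed

lemma sortings_key_eq:
  assumes "\<alpha> \<in> sortings n K" "\<beta> \<in> sortings n K" "u \<in> {1..n}" "v \<in> {1..n}" "\<alpha> u = \<beta> v"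
  shows "K u = K v"
  using sortings_key_le[OF assms] sortings_key_le[OF assms(2,1,4,3) assms(5)[symmetric]] by simp

text \<open>
  A pair \<open>\<alpha>, \<beta>\<close> with \<open>compatible n f \<alpha> \<beta>\<close> and \<open>compatible n g \<beta> \<alpha>\<close> amounts to a linear order on each
  fibre of \<open>(f, g)\<close>. There are as many of these as permutations fixing \<open>(f, g)\<close>, which makes the
  comparison with Burnside's sum possible.
\<close>

definition compatible :: "nat \<Rightarrow> (nat \<Rightarrow> nat) \<Rightarrow> (nat \<Rightarrow> nat) \<Rightarrow> (nat \<Rightarrow> nat) \<Rightarrow> bool" where
  "compatible n f \<alpha> \<beta> \<longleftrightarrow>
     (\<forall>u\<in>{1..n}. \<forall>v\<in>{1..n}. \<alpha> u < \<alpha> v \<longleftrightarrow> f u > f v \<or> f u = f v \<and> \<beta> u < \<beta> v)"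

text \<open>Listing the points by their \<open>\<alpha>\<close>-position turns \<open>f\<close> and
  \<open>\<beta>\<close> into the sequences \<open>F\<close> and \<open>\<rho>\<close>. For adjacent
  positions, compatibility says that \<open>F\<close> drops, or stays while \<open>\<rho>\<close>
  increases, which is the condition on descents; adjacent comparisons chain to all pairs.\<close>

lemma compatible_iff_descent_partition:
  assumes \<alpha>: "\<alpha> permutes {1..n}" and \<beta>: "\<beta> permutes {1..n}" and f: "f \<in> funs_on {1..n}"
  shows "compatible n f \<alpha> \<beta> \<longleftrightarrow> f \<circ> inv \<alpha> \<in> descent_partitions n (\<beta> \<circ> inv \<alpha>)"
proof
  have inv_mem: "inv \<alpha> k \<in> {1..n} \<longleftrightarrow> k \<in> {1..n}" for k
    by (rule permutes_in_image[OF permutes_inv[OF \<alpha>]])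
  have \<alpha>_inv: "\<alpha> (inv \<alpha> k) = k" for k
    using \<alpha> by (simp add: permutes_inverses)
  assume comp: "compatible n f \<alpha> \<beta>"
  show "f \<circ> inv \<alpha> \<in> descent_partitions n (\<beta> \<circ> inv \<alpha>)"
    unfolding descent_partitions_def
  proof (intro CollectI conjI ballI)
    show "f \<circ> inv \<alpha> \<in> funs_on {1..n}"
    proof -
      have "f (inv \<alpha> k) = 0" if "k \<notin> {1..n}" for k
        using f that unfolding inv_mem[symmetric, of k] funs_on_def by blast
      then show ?thesis
        by (simp add: funs_on_def)
    qed
    fix k assume "k \<in> {1..<n}"
    then have "inv \<alpha> k \<in> {1..n}" "inv \<alpha> (k + 1) \<in> {1..n}"
      unfolding inv_mem by auto
    then have *: "f (inv \<alpha> k) > f (inv \<alpha> (k + 1)) \<or>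
        f (inv \<alpha> k) = f (inv \<alpha> (k + 1)) \<and> \<beta> (inv \<alpha> k) < \<beta> (inv \<alpha> (k + 1))"
      using comp unfolding compatible_def by (metis \<alpha>_inv less_add_one)
    then show "(f \<circ> inv \<alpha>) (k + 1) \<le> (f \<circ> inv \<alpha>) k"
      and "(\<beta> \<circ> inv \<alpha>) (k + 1) < (\<beta> \<circ> inv \<alpha>) k \<longrightarrow> (f \<circ> inv \<alpha>) (k + 1) < (f \<circ> inv \<alpha>) k"
      by auto
  qed
next
  define F where "F = f \<circ> inv \<alpha>"
  define \<rho> where "\<rho> = \<beta> \<circ> inv \<alpha>"
  assume "f \<circ> inv \<alpha> \<in> descent_partitions n (\<beta> \<circ> inv \<alpha>)"
  then have F: "F (k + 1) \<le> F k" "\<rho> k > \<rho> (k + 1) \<longrightarrow> F (k + 1) < F k" if "k \<in> {1..<n}" for k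
    using that by (auto simp: descent_partitions_def F_def \<rho>_def)
  have "\<rho> permutes {1..n}"
    unfolding \<rho>_def using \<alpha> \<beta> by (intro permutes_compose permutes_inv)
  then have "inj \<rho>"
    by (rule permutes_inj)
  have mono: "F k > F l \<or> F k = F l \<and> \<rho> k < \<rho> l" if "k < l" "1 \<le> k" "l \<le> n" for k l
    using that
  proof (induction l)
    case (Suc l)
    have step: "F l > F (Suc l) \<or> F l = F (Suc l) \<and> \<rho> l < \<rho> (Suc l)"
      using F[of l] Suc.prems injD[OF \<open>inj \<rho>\<close>, of l "Suc l"] by fastforce
    show ?case
    proof (cases "k = l")
      case False
      then have "F k > F l \<or> F k = F l \<and> \<rho> k < \<rho> l"
        using Suc by simp
      with step show ?thesis
        by auto
    qed (use step in simp)
  qed simp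
  have sorted: "f u > f v \<or> f u = f v \<and> \<beta> u < \<beta> v" if "u \<in> {1..n}" "v \<in> {1..n}" "\<alpha> u < \<alpha> v" for u v
    using mono[of "\<alpha> u" "\<alpha> v"] that permutes_in_image[OF \<alpha>, of u] permutes_in_image[OF \<alpha>, of v]
    by (simp add: F_def \<rho>_def permutes_inverses[OF \<alpha>])
  show "compatible n f \<alpha> \<beta>"
    unfolding compatible_def
  proof (intro ballI iffI)
    fix u v assume uv: "u \<in> {1..n}" "v \<in> {1..n}" "f u > f v \<or> f u = f v \<and> \<beta> u < \<beta> v"
    then have "u \<noteq> v"
      by auto
    then have "\<alpha> u \<noteq> \<alpha> v"
      using permutes_inj[OF \<alpha>] by (auto dest: injD)
    then show "\<alpha> u < \<alpha> v"
      using sorted[OF uv(2,1)] uv(3) by (auto simp: neq_iff)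
  qed (use sorted in blast)
qed

lemma compatible_imp_sorting:
  assumes \<alpha>: "\<alpha> permutes {1..n}" and "compatible n f \<alpha> \<beta>" "compatible n g \<beta> \<alpha>"
  shows "\<alpha> \<in> sortings n (\<lambda>u. (f u, g u))"
  unfolding sortings_def
proof (intro CollectI conjI ballI impI)
  fix u v assume uv: "u \<in> {1..n}" "v \<in> {1..n}" "(f v, g v) < (f u, g u)"
  then have "f u > f v \<or> f u = f v \<and> g u > g v"
    by auto
  with assms(2,3) uv(1,2) show "\<alpha> u < \<alpha> v"
    unfolding compatible_def by blast
qed (rule \<alpha>)

text \<open>The condition on \<open>g\<close> determines \<open>\<beta>\<close>: sort by
  \<open>g\<close> and break ties by \<open>\<alpha>\<close>. The condition on \<open>f\<close> then
  holds because on a fibre of \<open>f\<close> both permutations follow decreasing \<open>g\<close>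
  and agree where \<open>g\<close> ties.\<close>

lemma sorting_imp_ex1_compatible:
  assumes \<alpha>: "\<alpha> \<in> sortings n (\<lambda>u. (f u, g u))"
  shows "\<exists>!\<beta>. \<beta> permutes {1..n} \<and> compatible n f \<alpha> \<beta> \<and> compatible n g \<beta> \<alpha>"
proof -
  have \<alpha>_perm: "\<alpha> permutes {1..n}"
    using \<alpha> by (simp add: sortings_def)
  have \<alpha>_less: "\<alpha> u < \<alpha> v" if "u \<in> {1..n}" "v \<in> {1..n}" "f u > f v \<or> f u = f v \<and> g u > g v" for u v
    using \<alpha> that unfolding sortings_def by auto
  have \<alpha>_inj: "\<alpha> u = \<alpha> v \<longleftrightarrow> u = v" for u v
    using permutes_inj[OF \<alpha>_perm] by (auto dest: injD)
  have "\<exists>\<beta>. \<beta> permutes {1..n} \<and>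
      (\<forall>u\<in>{1..n}. \<forall>v\<in>{1..n}. \<beta> u < \<beta> v \<longleftrightarrow> g u > g v \<or> g u = g v \<and> \<alpha> u < \<alpha> v)"
    by (rule ex_sorting_permutation) (use \<alpha>_inj in \<open>auto simp: not_less le_less\<close>)
  then obtain \<beta> where \<beta>: "\<beta> permutes {1..n}"
    "\<forall>u\<in>{1..n}. \<forall>v\<in>{1..n}. \<beta> u < \<beta> v \<longleftrightarrow> g u > g v \<or> g u = g v \<and> \<alpha> u < \<alpha> v"
    by blast
  show ?thesis
  proof (rule ex1I)
    have "compatible n f \<alpha> \<beta>"
      unfolding compatible_def
    proof (intro ballI)
      fix u v assume uv: "u \<in> {1..n}" "v \<in> {1..n}"
      show "\<alpha> u < \<alpha> v \<longleftrightarrow> f u > f v \<or> f u = f v \<and> \<beta> u < \<beta> v"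
        using \<alpha>_less[OF uv] \<alpha>_less[OF uv(2,1)] \<beta>(2) uv by (metis less_asym linorder_less_linear)
    qed
    with \<beta> show "\<beta> permutes {1..n} \<and> compatible n f \<alpha> \<beta> \<and> compatible n g \<beta> \<alpha>"
      by (simp add: compatible_def)
    fix \<gamma> assume \<gamma>: "\<gamma> permutes {1..n} \<and> compatible n f \<alpha> \<gamma> \<and> compatible n g \<gamma> \<alpha>"
    show "\<gamma> = \<beta>"
    proof (rule sorting_permutation_unique)
      fix u v assume uv: "u \<in> {1..n}" "v \<in> {1..n}"
      have "\<gamma> u < \<gamma> v \<longleftrightarrow> g u > g v \<or> g u = g v \<and> \<alpha> u < \<alpha> v"
        using \<gamma> uv unfolding compatible_def by blast
      then show "\<gamma> u < \<gamma> v \<longleftrightarrow> \<beta> u < \<beta> v"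
        using \<beta>(2) uv by blast
    qed (use \<gamma> \<beta>(1) in auto)
  qed
qed

section \<open>The generating function of the two major indices\<close>

definition bimaj_poly :: "nat \<Rightarrow> complex \<Rightarrow> complex \<Rightarrow> complex" where
  "bimaj_poly n x y = (\<Sum>\<pi> | \<pi> permutes {1..n}. x ^ maj n (inv \<pi>) * y ^ maj n \<pi>)"

lemma funs_on_comp_permutes:
  assumes "\<alpha> permutes S" "f \<in> funs_on S"
  shows "f \<circ> \<alpha> \<in> funs_on S"
  using assms by (auto simp: funs_on_def permutes_not_in)

text \<open>Both sides sum the weights of all pairs \<open>(f, g)\<close>, each counted once per
  permutation fixing it. Summing over \<open>\<sigma>\<close> first gives the left side. For the
  right side, a fixed sorting of \<open>(f, g)\<close> composed with such a \<open>\<sigma>\<close>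
  runs through all sortings \<open>\<alpha>\<close>, and each \<open>\<alpha>\<close> has a unique
  compatible \<open>\<beta>\<close>.\<close>

lemma sum_over_cycles_eq_bimaj_poly:
  assumes x: "norm x < 1" and y: "norm y < 1"
  shows "(\<Sum>\<sigma> | \<sigma> permutes {1..n}.
           (\<Prod>B\<in>cycles n \<sigma>. 1 / (1 - x ^ card B)) * (\<Prod>B\<in>cycles n \<sigma>. 1 / (1 - y ^ card B)))
       = fact n * bimaj_poly n x y * ((\<Prod>k=1..n. 1 / (1 - x ^ k)) * (\<Prod>k=1..n. 1 / (1 - y ^ k)))"
proof -
  define P where "P = {\<sigma>. \<sigma> permutes {1..n}}"
  have finP: "finite P"
    unfolding P_def by (simp add: finite_permutations)
  define wt :: "(nat \<Rightarrow> nat) \<times> (nat \<Rightarrow> nat) \<Rightarrow> complex"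
    where "wt = (\<lambda>(f, g). x ^ (\<Sum>k=1..n. f k) * y ^ (\<Sum>k=1..n. g k))"
  define X where "X = Sigma P (\<lambda>\<sigma>. invariants n \<sigma> \<times> invariants n \<sigma>)"
  \<comment> \<open>In a member \<open>((\<alpha>, \<beta>), F, G)\<close>, the sequences
    \<open>F\<close> and \<open>G\<close> are \<open>f\<close> and \<open>g\<close> listed in the
    order of \<open>\<alpha>\<close> and \<open>\<beta>\<close> respectively.\<close>
  define V where "V = Sigma (P \<times> P) (\<lambda>(\<alpha>, \<beta>).
      descent_partitions n (\<beta> \<circ> inv \<alpha>) \<times> descent_partitions n (\<alpha> \<circ> inv \<beta>))"
  define A where "A \<rho> z = z ^ maj n \<rho> * (\<Prod>k=1..n. 1 / (1 - z ^ k))" for \<rho> and z :: complex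

  have X_sum: "((\<lambda>p. wt (snd p)) has_sum (\<Sum>\<sigma>\<in>P.
      (\<Prod>B\<in>cycles n \<sigma>. 1 / (1 - x ^ card B)) * (\<Prod>B\<in>cycles n \<sigma>. 1 / (1 - y ^ card B)))) X"
    unfolding X_def
  proof (rule has_sum_Sigma_finite[OF finP])
    fix \<sigma> assume "\<sigma> \<in> P"
    then have "\<sigma> permutes {1..n}"
      by (simp add: P_def)
    from has_sum_times[OF has_sum_invariants[OF x this] has_sum_invariants[OF y this]]
    show "((\<lambda>b. wt (snd (\<sigma>, b))) has_sum
        (\<Prod>B\<in>cycles n \<sigma>. 1 / (1 - x ^ card B)) * (\<Prod>B\<in>cycles n \<sigma>. 1 / (1 - y ^ card B)))
        (invariants n \<sigma> \<times> invariants n \<sigma>)"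
      by (simp add: wt_def)
  qed
  have "((\<lambda>p. wt (snd p)) has_sum (\<Sum>q\<in>P \<times> P. case q of (\<alpha>, \<beta>) \<Rightarrow>
      A (\<beta> \<circ> inv \<alpha>) x * A (\<alpha> \<circ> inv \<beta>) y)) V"
    unfolding V_def
  proof (rule has_sum_Sigma_finite)
    show "finite (P \<times> P)"
      using finP by simp
    fix q assume "q \<in> P \<times> P"
    obtain \<alpha> \<beta> where q: "q = (\<alpha>, \<beta>)"
      by (cases q)
    from has_sum_times[OF has_sum_descent_partitions[OF x, of n "\<beta> \<circ> inv \<alpha>"]
        has_sum_descent_partitions[OF y, of n "\<alpha> \<circ> inv \<beta>"]]
    show "((\<lambda>b. wt (snd (q, b))) has_sum (case q of (\<alpha>, \<beta>) \<Rightarrow>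
        A (\<beta> \<circ> inv \<alpha>) x * A (\<alpha> \<circ> inv \<beta>) y)) (case q of (\<alpha>, \<beta>) \<Rightarrow>
        descent_partitions n (\<beta> \<circ> inv \<alpha>) \<times> descent_partitions n (\<alpha> \<circ> inv \<beta>))"
      by (simp add: wt_def q A_def)
  qed
  moreover have "(\<Sum>q\<in>P \<times> P. case q of (\<alpha>, \<beta>) \<Rightarrow> A (\<beta> \<circ> inv \<alpha>) x * A (\<alpha> \<circ> inv \<beta>) y)
      = fact n * bimaj_poly n x y * ((\<Prod>k=1..n. 1 / (1 - x ^ k)) * (\<Prod>k=1..n. 1 / (1 - y ^ k)))"
  proof -
    \<comment> \<open>The substitution \<open>\<pi> = \<alpha> \<circ> inv \<beta>\<close> shows
      that the inner sum does not depend on \<open>\<alpha>\<close>; the outer sum then contributes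
      the factor \<open>fact n\<close>.\<close>
    have "(\<Sum>\<beta>\<in>P. A (\<beta> \<circ> inv \<alpha>) x * A (\<alpha> \<circ> inv \<beta>) y) = (\<Sum>\<pi>\<in>P. A (inv \<pi>) x * A \<pi> y)"
      if \<alpha>: "\<alpha> \<in> P" for \<alpha>
    proof (rule sum.reindex_bij_witness[where i = "\<lambda>\<pi>. inv \<pi> \<circ> \<alpha>" and j = "\<lambda>\<beta>. \<alpha> \<circ> inv \<beta>"])
      have bij_\<alpha>: "bij \<alpha>"
        using \<alpha> by (auto simp: P_def permutes_bij)
      fix \<pi> assume "\<pi> \<in> P"
      then have \<pi>: "\<pi> permutes {1..n}" "bij \<pi>"
        by (auto simp: P_def permutes_bij)
      show "inv (\<alpha> \<circ> inv \<pi>) \<circ> \<alpha> = \<pi>"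
        using \<pi>(2) bij_\<alpha> by (simp add: o_inv_distrib bij_imp_bij_inv inv_inv_eq o_assoc[symmetric] bij_is_inj)
      show "\<alpha> \<circ> inv (inv \<pi> \<circ> \<alpha>) = \<pi>"
        using \<pi>(2) bij_\<alpha> \<alpha> by (simp add: o_inv_distrib bij_imp_bij_inv inv_inv_eq o_assoc P_def permutes_inv_o)
      show "\<alpha> \<circ> inv \<pi> \<in> P" "inv \<pi> \<circ> \<alpha> \<in> P"
        using \<pi> \<alpha> by (auto simp: P_def intro: permutes_compose permutes_inv)
      have "inv (\<alpha> \<circ> inv \<pi>) = \<pi> \<circ> inv \<alpha>"
        using \<pi>(2) bij_\<alpha> by (simp add: o_inv_distrib bij_imp_bij_inv inv_inv_eq)
      then show "A (inv (\<alpha> \<circ> inv \<pi>)) x * A (\<alpha> \<circ> inv \<pi>) y = A (\<pi> \<circ> inv \<alpha>) x * A (\<alpha> \<circ> inv \<pi>) y"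
        by simp
    qed
    then have "(\<Sum>\<alpha>\<in>P. \<Sum>\<beta>\<in>P. A (\<beta> \<circ> inv \<alpha>) x * A (\<alpha> \<circ> inv \<beta>) y) = of_nat (card P) * (\<Sum>\<pi>\<in>P. A (inv \<pi>) x * A \<pi> y)"
      by simp
    also have "card P = fact n"
      unfolding P_def using card_permutations[of "{1..n}" n] by simp
    also have "(\<Sum>\<pi>\<in>P. A (inv \<pi>) x * A \<pi> y) =
        bimaj_poly n x y * ((\<Prod>k=1..n. 1 / (1 - x ^ k)) * (\<Prod>k=1..n. 1 / (1 - y ^ k)))"
      unfolding bimaj_poly_def A_def P_def sum_distrib_right by (intro sum.cong) (auto simp: mult_ac)
    finally show ?thesis
      by (simp only: sum.cartesian_product mult.assoc of_nat_fact)
  qed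
  ultimately have V_sum: "((\<lambda>p. wt (snd p)) has_sum
      fact n * bimaj_poly n x y * ((\<Prod>k=1..n. 1 / (1 - x ^ k)) * (\<Prod>k=1..n. 1 / (1 - y ^ k)))) V"
    by simp

  \<comment> \<open>The reference sorting depends on \<open>(f, g)\<close> alone, so
    \<open>I\<close> can cancel it from \<open>\<alpha>\<close> to recover
    \<open>\<sigma>\<close>.\<close>
  define a0 where "a0 f g = (SOME \<alpha>. \<alpha> \<in> sortings n (\<lambda>u. (f u, g u)))" for f g :: "nat \<Rightarrow> nat"
  have a0: "a0 f g \<in> sortings n (\<lambda>u. (f u, g u))" for f g
    unfolding a0_def using sortings_nonempty by (simp add: some_in_eq)
  then have a0_perm: "a0 f g permutes {1..n}" for f g
    by (simp add: sortings_def)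
  define b where "b f g \<alpha> = (THE \<beta>. \<beta> permutes {1..n} \<and> compatible n f \<alpha> \<beta> \<and> compatible n g \<beta> \<alpha>)"
    for f g \<alpha>
  define J where "J = (\<lambda>(\<sigma>, f, g). let \<alpha> = a0 f g \<circ> \<sigma>; \<beta> = b f g \<alpha> in ((\<alpha>, \<beta>), f \<circ> inv \<alpha>, g \<circ> inv \<beta>))"
  define I where "I = (\<lambda>((\<alpha>, \<beta>), F :: nat \<Rightarrow> nat, G :: nat \<Rightarrow> nat). (inv (a0 (F \<circ> \<alpha>) (G \<circ> \<beta>)) \<circ> \<alpha>, F \<circ> \<alpha>, G \<circ> \<beta>))"

  have "((\<lambda>p. wt (snd p)) has_sum
      fact n * bimaj_poly n x y * ((\<Prod>k=1..n. 1 / (1 - x ^ k)) * (\<Prod>k=1..n. 1 / (1 - y ^ k)))) X \<longleftrightarrow>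
    ((\<lambda>p. wt (snd p)) has_sum
      fact n * bimaj_poly n x y * ((\<Prod>k=1..n. 1 / (1 - x ^ k)) * (\<Prod>k=1..n. 1 / (1 - y ^ k)))) V"
  proof (rule has_sum_reindex_bij_witness[where i = I and j = J])
    fix p assume "p \<in> X"
    then obtain \<sigma> f g where p: "p = (\<sigma>, f, g)" and \<sigma>: "\<sigma> permutes {1..n}"
      and fg: "f \<in> funs_on {1..n}" "g \<in> funs_on {1..n}" "f \<circ> \<sigma> = f" "g \<circ> \<sigma> = g"
      by (auto simp: X_def P_def invariants_def)
    define \<alpha> where "\<alpha> = a0 f g \<circ> \<sigma>"
    have \<alpha>_perm: "\<alpha> permutes {1..n}"
      unfolding \<alpha>_def using \<sigma> a0_perm by (rule permutes_compose)
    have "\<alpha> \<in> sortings n (\<lambda>u. (f u, g u))"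
      unfolding sortings_def
    proof (intro CollectI conjI ballI impI)
      fix u v assume uv: "u \<in> {1..n}" "v \<in> {1..n}" "(f v, g v) < (f u, g u)"
      have "\<sigma> u \<in> {1..n}" "\<sigma> v \<in> {1..n}"
        using uv(1,2) unfolding permutes_in_image[OF \<sigma>] .
      moreover have "f (\<sigma> w) = f w" "g (\<sigma> w) = g w" for w
        using fg(3,4) by (auto simp: fun_eq_iff)
      then have "(f (\<sigma> v), g (\<sigma> v)) < (f (\<sigma> u), g (\<sigma> u))"
        using uv(3) by (simp only:)
      ultimately show "\<alpha> u < \<alpha> v"
        using a0[of f g] unfolding \<alpha>_def sortings_def comp_apply by blast
    qed (rule \<alpha>_perm)
    from theI'[OF sorting_imp_ex1_compatible[OF this]]
    have b: "b f g \<alpha> permutes {1..n}" "compatible n f \<alpha> (b f g \<alpha>)" "compatible n g (b f g \<alpha>) \<alpha>"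
      by (simp_all add: b_def)
    have J: "J p = ((\<alpha>, b f g \<alpha>), f \<circ> inv \<alpha>, g \<circ> inv (b f g \<alpha>))"
      by (simp add: J_def p \<alpha>_def Let_def)
    have restore: "f \<circ> inv \<alpha> \<circ> \<alpha> = f" "g \<circ> inv (b f g \<alpha>) \<circ> b f g \<alpha> = g"
      using \<alpha>_perm b(1) by (simp_all add: o_assoc[symmetric] permutes_inv_o)
    have "inv (a0 f g) \<circ> \<alpha> = \<sigma>"
      unfolding \<alpha>_def using a0_perm[of f g] by (simp add: o_assoc permutes_inv_o)
    then show "I (J p) = p"
      unfolding J I_def using restore by (simp add: p)
    show "J p \<in> V"
      using \<alpha>_perm b compatible_iff_descent_partition[OF \<alpha>_perm b(1) fg(1)]
        compatible_iff_descent_partition[OF b(1) \<alpha>_perm fg(2)]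
      by (simp add: V_def P_def J)
    show "wt (snd (J p)) = wt (snd p)"
      using sum.permute[OF permutes_inv[OF \<alpha>_perm], of f] sum.permute[OF permutes_inv[OF b(1)], of g]
      unfolding J by (simp add: p wt_def)
  next
    fix q assume "q \<in> V"
    then obtain \<alpha> \<beta> F G where q: "q = ((\<alpha>, \<beta>), F, G)" and \<alpha>: "\<alpha> permutes {1..n}" and \<beta>: "\<beta> permutes {1..n}"
      and F: "F \<in> descent_partitions n (\<beta> \<circ> inv \<alpha>)" and G: "G \<in> descent_partitions n (\<alpha> \<circ> inv \<beta>)"
      by (auto simp: V_def P_def)
    define f where "f = F \<circ> \<alpha>"
    define g where "g = G \<circ> \<beta>"
    have FG: "f \<circ> inv \<alpha> = F" "g \<circ> inv \<beta> = G"
      using \<alpha> \<beta> by (simp_all add: f_def g_def o_assoc[symmetric] permutes_inv_o)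
    have fg: "f \<in> funs_on {1..n}" "g \<in> funs_on {1..n}"
      using F G \<alpha> \<beta> unfolding f_def g_def descent_partitions_def by (auto intro: funs_on_comp_permutes)
    have comp: "compatible n f \<alpha> \<beta>" "compatible n g \<beta> \<alpha>"
      using compatible_iff_descent_partition[OF \<alpha> \<beta> fg(1)] compatible_iff_descent_partition[OF \<beta> \<alpha> fg(2)]
      by (simp_all add: FG F G)
    then have sort: "\<alpha> \<in> sortings n (\<lambda>u. (f u, g u))"
      using \<alpha> by (intro compatible_imp_sorting)
    have b: "b f g \<alpha> = \<beta>"
      unfolding b_def using sorting_imp_ex1_compatible[OF sort] \<beta> comp by (intro the1_equality) auto
    define \<sigma> where "\<sigma> = inv (a0 f g) \<circ> \<alpha>"
    have \<sigma>: "\<sigma> permutes {1..n}"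
      unfolding \<sigma>_def using \<alpha> permutes_inv[OF a0_perm] by (rule permutes_compose)
    have a0\<sigma>: "a0 f g \<circ> \<sigma> = \<alpha>"
      unfolding \<sigma>_def using a0_perm[of f g] by (simp add: o_assoc permutes_inv_o)
    \<comment> \<open>\<open>a0 f g\<close> puts \<open>\<sigma> u\<close> at the position where
      \<open>\<alpha>\<close> puts \<open>u\<close>, and two sortings have the same key at each
      position.\<close>
    have "f (\<sigma> u) = f u \<and> g (\<sigma> u) = g u" for u
    proof (cases "u \<in> {1..n}")
      case True
      then have "\<sigma> u \<in> {1..n}"
        unfolding permutes_in_image[OF \<sigma>] .
      moreover have "a0 f g (\<sigma> u) = \<alpha> u"
        using a0\<sigma> by (auto simp: fun_eq_iff)
      ultimately show ?thesis
        using sortings_key_eq[OF a0 sort _ True, of "\<sigma> u"] by simp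
    next
      case False
      then show ?thesis
        using \<sigma> by (simp add: permutes_not_in)
    qed
    then have inv: "f \<circ> \<sigma> = f" "g \<circ> \<sigma> = g"
      by (auto simp: fun_eq_iff)
    have I: "I q = (\<sigma>, f, g)"
      by (simp add: I_def q \<sigma>_def f_def g_def)
    show "J (I q) = q"
      unfolding I J_def by (simp add: a0\<sigma> b q FG Let_def)
    show "I q \<in> X"
      using \<sigma> fg inv by (simp add: I X_def P_def invariants_def)
  qed (rule refl)
  with V_sum X_sum show ?thesis
    unfolding P_def[symmetric] by (blast intro: has_sum_unique)
qed

section \<open>Radial limits at roots of unity\<close>

text \<open>Evaluate at 1 the identity between the product of the \<open>X - z ^ k\<close> and the
  sum of the \<open>X ^ j\<close> for \<open>j < d\<close>. Both polynomials are monic of degree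
  \<open>d - 1\<close> and vanish at the \<open>d - 1\<close> distinct nontrivial powers of
  \<open>z\<close>.\<close>

lemma prod_one_minus_root_powers:
  assumes z: "z \<in> roots_of_order d" and d: "d > 0"
  shows "(\<Prod>k=1..<d. 1 - z ^ k) = of_nat d"
proof -
  define p where "p = (\<Prod>k=1..<d. [:- (z ^ k), 1:])"
  define q :: "complex poly" where "q = (\<Sum>j<d. monom 1 j)"
  have z_eq_1: "z ^ k = 1 \<longleftrightarrow> d dvd k" for k
    using z by (rule roots_of_order_power_eq_1_iff)
  then have "z \<noteq> 0"
    using d by (metis dvd_refl power_0_left zero_neq_one not_gr_zero)
  have inj: "inj_on (\<lambda>k. z ^ k) {1..<d}"
  proof (rule linorder_inj_onI)
    fix k l assume kl: "k < l" "k \<in> {1..<d}" "l \<in> {1..<d}"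
    have "z ^ (l - k) \<noteq> 1"
      using kl unfolding z_eq_1 by (auto dest!: dvd_imp_le)
    then show "z ^ k \<noteq> z ^ l"
      using kl \<open>z \<noteq> 0\<close> by (auto simp: power_diff)
  qed auto
  have deg_p: "degree p = d - 1"
    unfolding p_def by (subst degree_prod_sum_eq) auto
  have coeff_q: "coeff q j = (if j < d then 1 else 0)" for j
    by (simp add: q_def coeff_sum)
  have "p = q"
  proof (rule poly_eqI_degree_lead_coeff[where n = "d - 1" and A = "(\<lambda>k. z ^ k) ` {1..<d}"])
    have "lead_coeff p = 1"
      unfolding p_def lead_coeff_prod by simp
    then show "coeff p (d - 1) = coeff q (d - 1)"
      using d by (simp add: deg_p coeff_q)
    show "d - 1 \<le> card ((\<lambda>k. z ^ k) ` {1..<d})"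
      using card_image[OF inj] by simp
    show "degree p \<le> d - 1"
      by (simp add: deg_p)
    show "degree q \<le> d - 1"
      by (rule degree_le) (auto simp: coeff_q)
    fix w assume "w \<in> (\<lambda>k. z ^ k) ` {1..<d}"
    then obtain k where k: "k \<in> {1..<d}" "w = z ^ k"
      by auto
    have "w \<noteq> 1"
      using k unfolding k(2) z_eq_1 by (auto dest: dvd_imp_le)
    moreover have "w ^ d = 1"
      unfolding k(2) power_mult[symmetric] z_eq_1 by simp
    ultimately have "poly q w = 0"
      by (simp add: q_def poly_sum poly_monom geometric_sum)
    moreover have "poly p w = 0"
      using k by (auto simp: p_def poly_prod)
    ultimately show "poly p w = poly q w"
      by simp
  qed
  then have "poly p 1 = poly q 1"
    by simp
  then show ?thesis
    by (simp add: p_def q_def poly_prod poly_sum poly_monom)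
qed

text \<open>Each block of \<open>d\<close> consecutive exponents contributes \<open>d\<close> from
  the non-multiples of \<open>d\<close> and the one multiple \<open>d * Suc m\<close>.\<close>

lemma prod_cyclotomic_factors:
  assumes z: "z \<in> roots_of_order d" and d: "d > 0"
  shows "(\<Prod>k=1..d * m. if d dvd k then of_nat k else 1 - z ^ k) = (of_nat (d ^ m * d ^ m * fact m) :: complex)"
proof (induction m)
  case (Suc m)
  define h where "h = (\<lambda>k. if d dvd k then of_nat k else 1 - z ^ k)"
  have zd: "z ^ (d * m) = 1"
    using roots_of_order_power_eq_1_iff[OF z, of "d * m"] by simp
  have "{1..d * Suc m} = {1..d * m} \<union> {d * m + 1..d * m + d}"
    by (auto simp: algebra_simps)
  then have "prod h {1..d * Suc m} = prod h {1..d * m} * prod h {d * m + 1..d * m + d}"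
    by (simp only:) (rule prod.union_disjoint, auto)
  also have "prod h {d * m + 1..d * m + d} = prod (\<lambda>k. h (d * m + k)) {1..d}"
    using prod.shift_bounds_cl_nat_ivl[of h 1 "d * m" d] by (simp add: add.commute)
  also have "\<dots> = (\<Prod>k=1..<d. h (d * m + k)) * h (d * m + d)"
    using d by (cases d) (simp_all add: prod.cl_ivl_Suc atLeastLessThanSuc_atLeastAtMost)
  also have "(\<Prod>k=1..<d. h (d * m + k)) = (\<Prod>k=1..<d. 1 - z ^ k)"
  proof (rule prod.cong)
    fix k assume "k \<in> {1..<d}"
    then have "\<not> d dvd k"
      by (auto dest: dvd_imp_le)
    then show "h (d * m + k) = 1 - z ^ k"
      by (simp add: h_def dvd_add_right_iff power_add zd)
  qed simp
  also have "\<dots> = of_nat d"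
    by (rule prod_one_minus_root_powers[OF z d])
  also have "h (d * m + d) = of_nat (d * Suc m)"
    by (simp add: h_def)
  finally show ?case
    using Suc unfolding h_def by (simp add: algebra_simps)
qed simp

text \<open>If \<open>d\<close> divides \<open>s\<close>, the factor has a simple zero at
  \<open>r = 1\<close>; dividing by \<open>1 - r\<close> leaves a geometric sum of \<open>s\<close>
  terms, each tending to 1.\<close>

lemma tendsto_cyclotomic_factor:
  assumes z: "z \<in> roots_of_order d"
  shows "((\<lambda>r. (1 - (of_real r * z) ^ s) / (if d dvd s then of_real (1 - r) else 1)) \<longlongrightarrow>
           (if d dvd s then of_nat s else 1 - z ^ s)) (at_left (1::real))"
proof (cases "d dvd s")
  case True
  then have zs: "z ^ s = 1"
    using roots_of_order_power_eq_1_iff[OF z] by blast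
  have "((\<lambda>r. \<Sum>j<s. complex_of_real r ^ j) \<longlongrightarrow> (\<Sum>j<s. complex_of_real 1 ^ j)) (at_left 1)"
    by (intro tendsto_intros)
  moreover have "\<forall>\<^sub>F r in at_left (1::real).
      (\<Sum>j<s. complex_of_real r ^ j) = (1 - (of_real r * z) ^ s) / (if d dvd s then of_real (1 - r) else 1)"
    using eventually_at_left_real[of 0 1, OF zero_less_one]
  proof eventually_elim
    case (elim r)
    have "1 - complex_of_real r ^ s = (1 - of_real r) * (\<Sum>j<s. complex_of_real r ^ j)"
      by (rule one_diff_power_eq)
    moreover have "1 - complex_of_real r \<noteq> 0"
      using elim by (simp add: complex_eq_iff)
    ultimately show ?case
      using True by (simp add: power_mult_distrib zs)
  qed
  ultimately show ?thesis
    using True by (auto dest: Lim_transform_eventually)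
next
  case False
  have "((\<lambda>r. 1 - (of_real r * z) ^ s) \<longlongrightarrow> 1 - (of_real 1 * z) ^ s) (at_left (1::real))"
    by (intro tendsto_intros)
  then show ?thesis
    using False by simp
qed

definition cycle_quotient :: "nat \<Rightarrow> (nat \<Rightarrow> nat) \<Rightarrow> complex \<Rightarrow> complex" where
  "cycle_quotient n \<sigma> x = (\<Prod>k=1..n. 1 - x ^ k) / (\<Prod>B\<in>cycles n \<sigma>. 1 - x ^ card B)"

text \<open>At \<open>z\<close> the numerator vanishes to order \<open>n div d\<close> and the
  denominator to order \<open>card D\<close>, the number of cycles whose length is divisible by
  \<open>d\<close>. The orders coincide only if all cycles have length \<open>d\<close>; then the
  regular factors give the limit.\<close>

lemma tendsto_cycle_quotient:
  assumes z: "z \<in> roots_of_order d" and n: "n > 0" and dn: "d dvd n"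
  shows "((\<lambda>r. cycle_quotient n \<sigma> (of_real r * z)) \<longlongrightarrow>
    (if \<forall>B\<in>cycles n \<sigma>. card B = d then of_nat (d ^ (n div d) * fact (n div d)) else 0)) (at_left 1)"
proof -
  obtain m where nm: "n = d * m"
    using dn by blast
  have d: "d > 0" and m: "n div d = m"
    using n nm by auto
  define C where "C = cycles n \<sigma>"
  define D where "D = {B \<in> C. d dvd card B}"
  have finC: "finite C" and card_pos: "\<And>B. B \<in> C \<Longrightarrow> card B > 0" and sum_card: "(\<Sum>B\<in>C. card B) = n"
    using cycles_partition[where n = n and \<sigma> = \<sigma>] sum_card_cycles[of n \<sigma>] by (auto simp: C_def card_gt_0_iff)
  define lim :: "nat \<Rightarrow> complex" where "lim s = (if d dvd s then of_nat s else 1 - z ^ s)" for s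
  define h :: "real \<Rightarrow> nat \<Rightarrow> complex"
    where "h r s = (1 - (of_real r * z) ^ s) / (if d dvd s then of_real (1 - r) else 1)" for r s
  have h_lim: "((\<lambda>r. h r s) \<longlongrightarrow> lim s) (at_left 1)" for s
    unfolding h_def lim_def by (rule tendsto_cyclotomic_factor[OF z])
  have lim_nz: "lim s \<noteq> 0" if "s > 0" for s
    using that roots_of_order_power_eq_1_iff[OF z, of s] by (auto simp: lim_def)

  \<comment> \<open>Each cycle in \<open>D\<close> has at least \<open>d\<close> elements, so the
    total length \<open>n = d * m\<close> bounds \<open>card D\<close> by \<open>m\<close>. Equality
    forces equality in every term of the comparison.\<close>
  have sum_if: "(\<Sum>B\<in>C. if d dvd card B then d else 0) = d * card D"
    unfolding D_def using finC by (simp add: sum.If_cases Int_def mult.commute)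
  have le: "(if d dvd card B then d else 0) \<le> card B" if "B \<in> C" for B
    using card_pos[OF that] by (auto intro: dvd_imp_le)
  have "d * card D \<le> d * m"
    unfolding sum_if[symmetric] nm[symmetric] sum_card[symmetric] by (rule sum_mono) (rule le)
  then have Dm: "card D \<le> m"
    using d by simp
  have all_d: "card B = d" if "card D = m" "B \<in> C" for B
  proof -
    have "(\<Sum>B\<in>C. if d dvd card B then d else 0) = (\<Sum>B\<in>C. card B)"
      unfolding sum_if sum_card by (simp add: that nm)
    then have "(if d dvd card B then d else 0) = card B"
      using sum_mono_inv[where f = "\<lambda>B. if d dvd card B then d else 0" and g = card, OF _ le \<open>B \<in> C\<close> finC] by simp
    then show ?thesis
      using card_pos[OF \<open>B \<in> C\<close>] by (auto split: if_splits)
  qed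
  have multiples: "card {k \<in> {1..n}. d dvd k} = m"
  proof -
    have "{k \<in> {1..n}. d dvd k} = (\<lambda>k. d * k) ` {1..m}"
      using d by (auto simp: nm elim!: dvdE)
    then show ?thesis
      using d by (simp add: card_image inj_on_def)
  qed

  have eq: "cycle_quotient n \<sigma> (of_real r * z) =
      (\<Prod>k=1..n. h r k) / (\<Prod>B\<in>C. h r (card B)) * of_real (1 - r) ^ (m - card D)" if "r < 1" for r
  proof -
    have r: "complex_of_real (1 - r) \<noteq> 0"
      using that by (simp add: complex_eq_iff)
    have h_eq: "1 - (of_real r * z) ^ s = h r s * (if d dvd s then of_real (1 - r) else 1)" for s
      using r by (simp add: h_def)
    have "(\<Prod>k=1..n. 1 - (of_real r * z) ^ k) = (\<Prod>k=1..n. h r k) * of_real (1 - r) ^ m"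
      unfolding h_eq prod.distrib multiples[symmetric] by (simp add: prod.If_cases Int_def)
    moreover have "(\<Prod>B\<in>C. 1 - (of_real r * z) ^ card B) = (\<Prod>B\<in>C. h r (card B)) * of_real (1 - r) ^ card D"
      unfolding h_eq prod.distrib D_def using finC by (simp add: prod.If_cases Int_def)
    moreover have "complex_of_real (1 - r) ^ m = of_real (1 - r) ^ card D * of_real (1 - r) ^ (m - card D)"
      using Dm by (simp flip: power_add)
    ultimately show ?thesis
      unfolding cycle_quotient_def C_def[symmetric] using r by (simp del: of_real_diff)
  qed
  \<comment> \<open>The factor \<open>of_real (1 - 1) ^ (m - card D)\<close> makes the case
    distinction: it is \<open>0 ^ 0 = 1\<close> if the orders of vanishing agree and 0
    otherwise.\<close>
  have "((\<lambda>r. (\<Prod>k=1..n. h r k) / (\<Prod>B\<in>C. h r (card B)) * of_real (1 - r) ^ (m - card D)) \<longlongrightarrow>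
      (\<Prod>k=1..n. lim k) / (\<Prod>B\<in>C. lim (card B)) * of_real (1 - 1) ^ (m - card D)) (at_left 1)"
    using finC card_pos lim_nz by (intro tendsto_intros h_lim) auto
  moreover have "\<forall>\<^sub>F r in at_left 1. (\<Prod>k=1..n. h r k) / (\<Prod>B\<in>C. h r (card B)) * of_real (1 - r) ^ (m - card D)
      = cycle_quotient n \<sigma> (of_real r * z)"
    using eventually_at_left_real[of 0 1, OF zero_less_one] by eventually_elim (simp only: eq greaterThanLessThan_iff)
  ultimately have lim: "((\<lambda>r. cycle_quotient n \<sigma> (of_real r * z)) \<longlongrightarrow>
      (\<Prod>k=1..n. lim k) / (\<Prod>B\<in>C. lim (card B)) * of_real (1 - 1) ^ (m - card D)) (at_left 1)"
    by (rule Lim_transform_eventually)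
  show ?thesis
  proof (cases "\<forall>B\<in>C. card B = d")
    case True
    then have "D = C"
      by (auto simp: D_def)
    moreover have "card C = m"
      using True sum_card d by (simp add: nm)
    moreover have "(\<Prod>B\<in>C. lim (card B)) = of_nat d ^ m"
      using True \<open>card C = m\<close> by (simp add: lim_def)
    moreover have "(\<Prod>k=1..n. lim k) = of_nat (d ^ m * d ^ m * fact m)"
      unfolding lim_def nm by (rule prod_cyclotomic_factors[OF z d])
    ultimately show ?thesis
      using lim True d by (simp add: C_def m)
  next
    case False
    then have "m - card D > 0"
      using all_d Dm by (metis le_neq_implies_less zero_less_diff)
    then show ?thesis
      using lim unfolding C_def[symmetric] if_not_P[OF False] by (simp add: power_0_left)
  qed
qed

section \<open>Fourier inversion\<close>

lemma bimaj_poly_eq_cycle_quotients: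
  assumes x: "norm x < 1" and y: "norm y < 1"
  shows "fact n * bimaj_poly n x y = (\<Sum>\<sigma> | \<sigma> permutes {1..n}. cycle_quotient n \<sigma> x * cycle_quotient n \<sigma> y)"
proof -
  define Q where "Q z = (\<Prod>k=1..n. 1 - z ^ k)" for z :: complex
  have nz: "Q z \<noteq> 0" if "norm z < 1" for z
  proof -
    have "z ^ k \<noteq> 1" if "k \<ge> 1" for k
    proof
      assume "z ^ k = 1"
      then have "norm z ^ k = 1"
        by (metis norm_one norm_power)
      then show False
        using \<open>norm z < 1\<close> \<open>k \<ge> 1\<close> power_less_one_iff[of "norm z" k] by simp
    qed
    then show ?thesis
      by (auto simp: Q_def)
  qed
  have "(\<Sum>\<sigma> | \<sigma> permutes {1..n}. cycle_quotient n \<sigma> x * cycle_quotient n \<sigma> y) =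
      Q x * Q y * (\<Sum>\<sigma> | \<sigma> permutes {1..n}.
        (\<Prod>B\<in>cycles n \<sigma>. 1 / (1 - x ^ card B)) * (\<Prod>B\<in>cycles n \<sigma>. 1 / (1 - y ^ card B)))"
    unfolding sum_distrib_left by (intro sum.cong) (simp_all add: cycle_quotient_def Q_def prod_dividef)
  also have "\<dots> = Q x * Q y * (fact n * bimaj_poly n x y * (1 / Q x * (1 / Q y)))"
    unfolding sum_over_cycles_eq_bimaj_poly[OF x y] by (simp add: Q_def prod_dividef)
  also have "\<dots> = fact n * bimaj_poly n x y"
    using nz[OF x] nz[OF y] by simp
  finally show ?thesis ..
qed

section \<open>The specialisation at \<open>y = 0\<close>\<close>

lemma maj_eq_0_imp_id:
  assumes \<pi>: "\<pi> permutes {1..n}" and maj: "maj n \<pi> = 0"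
  shows "\<pi> = id"
proof (rule sorting_permutation_unique[OF \<pi> permutes_id])
  have step: "\<pi> k < \<pi> (Suc k)" if "1 \<le> k" "k < n" for k
  proof -
    have "finite {i. 1 \<le> i \<and> i < n \<and> \<pi> i > \<pi> (i + 1)}"
      by (rule finite_subset[of _ "{..<n}"]) auto
    then have "\<not> \<pi> k > \<pi> (k + 1)"
      using maj that by (auto simp: maj_def)
    moreover have "\<pi> k \<noteq> \<pi> (Suc k)"
      using permutes_inj[OF \<pi>] by (auto dest: injD)
    ultimately show ?thesis
      by simp
  qed
  have mono: "\<pi> u < \<pi> v" if "u < v" "1 \<le> u" "v \<le> n" for u v
    using that
  proof (induction v)
    case (Suc v)
    show ?case
    proof (cases "u = v")
      case False
      then have "\<pi> u < \<pi> v"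
        using Suc by simp
      then show ?thesis
        using step[of v] Suc.prems by simp
    qed (use step Suc.prems in simp)
  qed simp
  fix u v assume "u \<in> {1..n}" "v \<in> {1..n}"
  then show "\<pi> u < \<pi> v \<longleftrightarrow> id u < id v"
    using mono[of u v] mono[of v u] by (cases u v rule: linorder_cases) auto
qed

text \<open>Only permutations with \<open>maj n \<pi> = 0\<close> survive, where
  \<open>0 ^ 0 = 1\<close>; the identity is the only one.\<close>

lemma bimaj_poly_0: "bimaj_poly n x 0 = 1"
proof -
  have "bimaj_poly n x 0 = (\<Sum>\<pi> | \<pi> permutes {1..n}. if \<pi> = id then 1 else 0)"
    unfolding bimaj_poly_def
  proof (rule sum.cong)
    fix \<pi> assume "\<pi> \<in> {\<pi>. \<pi> permutes {1..n}}"
    then have "maj n \<pi> = 0 \<Longrightarrow> \<pi> = id"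
      by (auto intro: maj_eq_0_imp_id)
    moreover have "maj n id = 0"
      by (auto simp: maj_def)
    ultimately show "x ^ maj n (inv \<pi>) * 0 ^ maj n \<pi> = (if \<pi> = id then 1 else 0)"
      by (auto simp: power_0_left)
  qed simp
  also have "\<dots> = 1"
    by (simp add: finite_permutations permutes_id)
  finally show ?thesis .
qed

lemma cycle_quotient_0: "cycle_quotient n \<sigma> 0 = 1"
proof -
  have "card B > 0" if "B \<in> cycles n \<sigma>" for B
    using cycles_partition(3,4)[OF that] by (simp add: card_gt_0_iff)
  then have "(\<Prod>B\<in>cycles n \<sigma>. 1 - 0 ^ card B) = (1::complex)"
    by (intro prod.neutral) (simp add: zero_power)
  then show ?thesis
    by (simp add: cycle_quotient_def power_0_left)
qed

text \<open>\<open>bimaj_poly\<close> is continuous, so its value at \<open>(z, w)\<close> is its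
  radial limit, which the cycle quotients give term by term. Only permutations whose cycles all have
  length \<open>d\<close> and also length \<open>e\<close> contribute.\<close>

lemma bimaj_poly_roots_of_order:
  assumes n: "n > 0" and z: "z \<in> roots_of_order d" "d dvd n" and w: "w \<in> roots_of_order e" "e dvd n"
  shows "bimaj_poly n z w = (if d = e then of_nat (d ^ (n div d) * fact (n div d)) else 0)"
proof -
  define c :: "nat \<Rightarrow> complex" where "c d = of_nat (d ^ (n div d) * fact (n div d))" for d
  \<comment> \<open>As an indicator, \<open>u d\<close> is idempotent; for \<open>d = e\<close> this
    turns the main sum into \<open>c d\<close> times the sum in \<open>count\<close>.\<close>
  define u :: "nat \<Rightarrow> (nat \<Rightarrow> nat) \<Rightarrow> complex"
    where "u d \<sigma> = (if \<forall>B\<in>cycles n \<sigma>. card B = d then 1 else 0)" for d \<sigma>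
  define P where "P = {\<sigma>. \<sigma> permutes {1..n}}"
  have lim: "((\<lambda>r. cycle_quotient n \<sigma> (of_real r * z)) \<longlongrightarrow> c d * u d \<sigma>) (at_left 1)"
    if "z \<in> roots_of_order d" "d dvd n" for z d \<sigma>
    using tendsto_cycle_quotient[OF that(1) n that(2), of \<sigma>] by (simp add: c_def u_def if_distrib cong: if_cong)
  have norm_1: "norm z = 1" if "z \<in> roots_of_order d" "d dvd n" for z d
  proof -
    have "z ^ n = 1"
      using roots_of_order_power_eq_1_iff[OF that(1)] that(2) by blast
    then show ?thesis
      using n power_eq_1_iff by blast
  qed
  have norm_less: "norm (of_real r * z) < 1" if "r \<in> {0<..<1}" "z \<in> roots_of_order d" "d dvd n" for r z d
    using norm_1[OF that(2,3)] that(1) by (simp add: norm_mult)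

  have "((\<lambda>r. fact n * bimaj_poly n (of_real r * z) (of_real r * w)) \<longlongrightarrow>
      fact n * bimaj_poly n (of_real 1 * z) (of_real 1 * w)) (at_left 1)"
    unfolding bimaj_poly_def by (intro tendsto_intros)
  moreover have "((\<lambda>r. fact n * bimaj_poly n (of_real r * z) (of_real r * w)) \<longlongrightarrow>
      (\<Sum>\<sigma>\<in>P. (c d * u d \<sigma>) * (c e * u e \<sigma>))) (at_left 1)"
  proof (rule Lim_transform_eventually)
    show "((\<lambda>r. \<Sum>\<sigma>\<in>P. cycle_quotient n \<sigma> (of_real r * z) * cycle_quotient n \<sigma> (of_real r * w)) \<longlongrightarrow>
        (\<Sum>\<sigma>\<in>P. (c d * u d \<sigma>) * (c e * u e \<sigma>))) (at_left 1)"
      by (intro tendsto_intros lim z w)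
    show "\<forall>\<^sub>F r in at_left 1. (\<Sum>\<sigma>\<in>P. cycle_quotient n \<sigma> (of_real r * z) * cycle_quotient n \<sigma> (of_real r * w)) =
        fact n * bimaj_poly n (of_real r * z) (of_real r * w)"
      using eventually_at_left_real[of 0 1, OF zero_less_one]
    proof eventually_elim
      case (elim r)
      show ?case
        unfolding P_def
        by (rule bimaj_poly_eq_cycle_quotients[symmetric, OF norm_less[OF elim z] norm_less[OF elim w]])
    qed
  qed
  ultimately have "fact n * bimaj_poly n (of_real 1 * z) (of_real 1 * w) =
      (\<Sum>\<sigma>\<in>P. (c d * u d \<sigma>) * (c e * u e \<sigma>))"
    by (rule tendsto_unique[OF trivial_limit_at_left_real])
  then have main: "fact n * bimaj_poly n z w = (\<Sum>\<sigma>\<in>P. (c d * u d \<sigma>) * (c e * u e \<sigma>))"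
    by simp

  (* The specialisation y = 0 counts the permutations whose cycles all have length d. *)
  have "((\<lambda>r. fact n) \<longlongrightarrow> (\<Sum>\<sigma>\<in>P. c d * u d \<sigma>)) (at_left (1::real))"
  proof (rule Lim_transform_eventually)
    show "((\<lambda>r. \<Sum>\<sigma>\<in>P. cycle_quotient n \<sigma> (of_real r * z)) \<longlongrightarrow> (\<Sum>\<sigma>\<in>P. c d * u d \<sigma>)) (at_left 1)"
      by (intro tendsto_intros lim z)
    show "\<forall>\<^sub>F r in at_left 1. (\<Sum>\<sigma>\<in>P. cycle_quotient n \<sigma> (of_real r * z)) = fact n"
      using eventually_at_left_real[of 0 1, OF zero_less_one]
    proof eventually_elim
      case (elim r)
      show ?case
        using bimaj_poly_eq_cycle_quotients[OF norm_less[OF elim z], of 0 n]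
        by (simp add: P_def bimaj_poly_0 cycle_quotient_0)
    qed
  qed
  then have count: "fact n = (\<Sum>\<sigma>\<in>P. c d * u d \<sigma>)"
    by (rule tendsto_unique[OF trivial_limit_at_left_real tendsto_const])

  show ?thesis
  proof (cases "d = e")
    case True
    have "fact n * bimaj_poly n z w = (\<Sum>\<sigma>\<in>P. c d * (c d * u d \<sigma>))"
      unfolding main by (intro sum.cong) (auto simp: True u_def)
    also have "\<dots> = fact n * c d"
      using count by (simp flip: sum_distrib_left)
    finally show ?thesis
      using True by (simp add: c_def)
  next
    case False
    \<comment> \<open>Without any cycle, both length conditions would hold vacuously.\<close>
    have "cycles n \<sigma> \<noteq> {}" for \<sigma>
      using cycles_partition(1)[of n \<sigma>] n by auto
    then have "u d \<sigma> * u e \<sigma> = 0" for \<sigma>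
      using False by (auto simp: u_def)
    then have "fact n * bimaj_poly n z w = 0"
      unfolding main by (intro sum.neutral) (simp add: mult_ac)
    then show ?thesis
      using False by simp
  qed
qed

text \<open>Orthogonality of characters: the sum over \<open>z\<close> detects the residue
  \<open>j\<close> of \<open>maj n (inv \<pi>)\<close>, the sum over \<open>w\<close> the residue
  \<open>i\<close> of \<open>maj n \<pi>\<close>, each with a factor \<open>n\<close>.\<close>

lemma maj_count_eq_character_sum:
  assumes n: "n > 0"
  shows "of_nat n ^ 2 * of_nat (maj_count n n n i j) =
    (\<Sum>z | z ^ n = 1. \<Sum>w | w ^ n = 1. z ^ j * w ^ i * bimaj_poly n (inverse z) (inverse w))"
proof -
  define P where "P = {\<pi>. \<pi> permutes {1..n}}"
  have finP: "finite P"
    unfolding P_def by (simp add: finite_permutations)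
  have "(\<Sum>z | z ^ n = 1. \<Sum>w | w ^ n = 1. z ^ j * w ^ i * bimaj_poly n (inverse z) (inverse w)) =
      (\<Sum>z | z ^ n = 1. \<Sum>w | w ^ n = 1. \<Sum>\<pi>\<in>P.
        (z ^ j * inverse z ^ maj n (inv \<pi>)) * (w ^ i * inverse w ^ maj n \<pi>))"
    unfolding bimaj_poly_def P_def sum_distrib_left by (intro sum.cong refl) (simp add: mult_ac)
  also have "\<dots> = (\<Sum>\<pi>\<in>P. \<Sum>z | z ^ n = 1. \<Sum>w | w ^ n = 1.
        (z ^ j * inverse z ^ maj n (inv \<pi>)) * (w ^ i * inverse w ^ maj n \<pi>))"
    by (subst sum.swap, subst (2) sum.swap) (rule refl)
  also have "\<dots> = (\<Sum>\<pi>\<in>P. (if [maj n (inv \<pi>) = j] (mod n) then of_nat n else 0) *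
        (if [maj n \<pi> = i] (mod n) then of_nat n else 0))"
    by (simp only: sum_product[symmetric] sum_roots_unity_power_inverse[OF n])
  also have "\<dots> = (\<Sum>\<pi>\<in>P. if [maj n \<pi> = i] (mod n) \<and> [maj n (inv \<pi>) = j] (mod n) then of_nat n ^ 2 else 0)"
    by (intro sum.cong) (auto simp: power2_eq_square)
  also have "\<dots> = of_nat n ^ 2 * of_nat (maj_count n n n i j)"
    using finP unfolding maj_count_def P_def
    by (simp add: sum.inter_filter[symmetric] mult.commute)
  finally show ?thesis ..
qed

theorem theorem4p1:
  fixes n i j :: nat
  assumes "n \<ge> 1"
    and "1 \<le> i" "i \<le> n"
    and "1 \<le> j" "j \<le> n"
  shows "real (maj_count n n n i j) =
    1 / real n ^ 2 *
      (\<Sum>d | d dvd n.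
         real d ^ (n div d) * fact (n div d) * real (totient d) ^ 2 *
         ((real_of_int (moebius_mu (d div gcd i d)) * real_of_int (moebius_mu (d div gcd j d))) /
          (real (totient (d div gcd i d)) * real (totient (d div gcd j d)))))"
proof -
  have n: "n > 0"
    using assms(1) by simp
  define c where "c d = real d ^ (n div d) * fact (n div d)" for d
  define D where "D = {d. d dvd n}"
  have finD: "finite D"
    using n by (simp add: D_def)
  \<comment> \<open>Inverting a root of unity preserves its order, so the evaluation applies to
    \<open>inverse z\<close> and \<open>inverse w\<close>.\<close>
  have poly: "bimaj_poly n (inverse z) (inverse w) = (if d = e then of_real (c d) else 0)"
    if "z \<in> roots_of_order d" "w \<in> roots_of_order e" "d \<in> D" "e \<in> D" for z w d e
    using bimaj_poly_roots_of_order[OF n inverse_roots_of_order[OF that(1)] _ inverse_roots_of_order[OF that(2)]]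
      that(3,4) by (simp add: D_def c_def)
  have "complex_of_real (real n ^ 2 * real (maj_count n n n i j)) =
      (\<Sum>d\<in>D. \<Sum>z\<in>roots_of_order d. \<Sum>e\<in>D. \<Sum>w\<in>roots_of_order e.
        z ^ j * w ^ i * bimaj_poly n (inverse z) (inverse w))"
    using maj_count_eq_character_sum[OF n, of i j]
    unfolding sum_roots_unity_eq_sum_order[OF n] by (simp add: D_def)
  also have "\<dots> = (\<Sum>d\<in>D. \<Sum>z\<in>roots_of_order d. \<Sum>e\<in>D. if d = e then
      (\<Sum>w\<in>roots_of_order e. z ^ j * w ^ i * of_real (c d)) else 0)"
    by (intro sum.cong refl) (auto simp: poly)
  also have "\<dots> = (\<Sum>d\<in>D. \<Sum>z\<in>roots_of_order d. \<Sum>w\<in>roots_of_order d. z ^ j * w ^ i * of_real (c d))"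
    using finD by (intro sum.cong refl) simp
  \<comment> \<open>Only the diagonal \<open>d = e\<close> remains, and there the double sum factors
    into two Ramanujan sums.\<close>
  also have "\<dots> = (\<Sum>d\<in>D. of_real (c d) * ((\<Sum>z\<in>roots_of_order d. z ^ j) * (\<Sum>w\<in>roots_of_order d. w ^ i)))"
    unfolding sum_product by (simp add: sum_distrib_left mult_ac)
  also have "\<dots> = (\<Sum>d\<in>D. of_real (c d) * (of_real (hoelder j d) * of_real (hoelder i d)))"
    using n by (intro sum.cong refl) (auto simp: D_def sum_roots_of_order_power dvd_pos_nat)
  also have "\<dots> = of_real (\<Sum>d\<in>D. c d * (hoelder j d * hoelder i d))"
    by simp
  finally have "real n ^ 2 * real (maj_count n n n i j) = (\<Sum>d\<in>D. c d * (hoelder j d * hoelder i d))"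
    by (simp only: of_real_eq_iff)
  also have "\<dots> = (\<Sum>d | d dvd n.
         real d ^ (n div d) * fact (n div d) * real (totient d) ^ 2 *
         ((real_of_int (moebius_mu (d div gcd i d)) * real_of_int (moebius_mu (d div gcd j d))) /
          (real (totient (d div gcd i d)) * real (totient (d div gcd j d)))))"
    unfolding D_def by (intro sum.cong refl) (simp add: c_def hoelder_def power2_eq_square mult_ac)
  finally show ?thesis
    using n by (simp add: field_simps)
qed

end
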